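(* Every element of $\mathcal P=\mathbb C[M]\cdot e^{-r^2}$ is an analytic vector of the left regular representation $\pi$ of $G$ on $\mathrm C_0(M)$; that is, for every $\varphi\in\mathcal P$ the map $G\to \mathrm C_0(M)$, $g\mapsto\pi(g)\varphi$, is analytic.
   Context: $G\subset \mathrm{GL}(n,\mathbb R)$ is a real linear algebraic group (a closed subgroup of $\mathrm{GL}(n,\mathbb R)$, regarded as a real analytic Lie group), and $M\subset\mathbb R^n$ is a smooth real affine algebraic variety on which $G$ acts regularly; the action of $G$ on $M\subset \mathbb R^n$ is by matrices, i.e. $(g,m)\mapsto gm$ is matrix multiplication. $\mathrm C_0(M)$ is the Banach space of continuous complex valued functions on $M$ vanishing at infinity, with the supremum norm, and $(\pi(g)\varphi)(m)=\varphi(g^{-1}m)$. $\mathbb C[M]$ is the ring of all functions on $M$ obtained by restricting polynomials (with complex coefficients) on $\mathbb R^n$ to $M$, $r^2(m)=m_1^2+\dots+m_n^2$, and $\mathcal P=\mathbb C[M]\cdot e^{-r^2}\subset \mathrm C_0(M)$. A vector $\varphi$ of a Banach representation $(\pi,\mathcal B)$ of $G$ is analytic if $g\mapsto\pi(g)\varphi$ is a (real) analytic map from $G$ to the Banach space $\mathcal B$. *)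

theory Defs
  imports "HOL-Analysis.Analysis"
begin

section \<open>Real affine algebraic sets\<close>

definition algebraic_set :: "'a::real_normed_vector set \<Rightarrow> bool" where
  "algebraic_set Z \<longleftrightarrow>
     (\<exists>S. (\<forall>p\<in>S. real_polynomial_function p) \<and> Z = {x. \<forall>p\<in>S. p x = 0})"

definition irreducible_algebraic_set :: "'a::real_normed_vector set \<Rightarrow> bool" where
  "irreducible_algebraic_set Z \<longleftrightarrow> algebraic_set Z \<and> Z \<noteq> {} \<and>
     (\<forall>A B. algebraic_set A \<and> algebraic_set B \<and> Z = A \<union> B \<longrightarrow> A = Z \<or> B = Z)"

definition algebraic_dim :: "'a::real_normed_vector set \<Rightarrow> enat" where
  "algebraic_dim Z = Sup {enat k | k.
     \<exists>C :: nat \<Rightarrow> 'a set. (\<forall>i\<le>k. irreducible_algebraic_set (C i) \<and> C i \<subseteq> Z) \<and>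
       (\<forall>i<k. C i \<subset> C (Suc i))}"

definition local_algebraic_dim :: "'a::real_normed_vector set \<Rightarrow> 'a \<Rightarrow> enat" where
  "local_algebraic_dim M m =
     Sup (algebraic_dim ` {Z. irreducible_algebraic_set Z \<and> Z \<subseteq> M \<and> m \<in> Z})"

definition vanishing_ideal :: "'a::real_normed_vector set \<Rightarrow> ('a \<Rightarrow> real) set" where
  "vanishing_ideal M = {p. real_polynomial_function p \<and> (\<forall>x\<in>M. p x = 0)}"

definition zariski_tangent_space :: "'a::real_normed_vector set \<Rightarrow> 'a \<Rightarrow> 'a set" where
  "zariski_tangent_space M m =
     {v. \<forall>p\<in>vanishing_ideal M. frechet_derivative p (at m) v = 0}"

text \<open>
  Smoothness means that every point is regular: the Zariski tangent space, taken with respect to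
  the full vanishing ideal, has the local dimension of \<open>M\<close>. Neither irreducibility nor
  equidimensionality is required.
\<close>

definition smooth_affine_variety :: "'a::euclidean_space set \<Rightarrow> bool" where
  "smooth_affine_variety M \<longleftrightarrow> algebraic_set M \<and>
     (\<forall>m\<in>M. enat (dim (zariski_tangent_space M m)) = local_algebraic_dim M m)"


section \<open>Real linear algebraic groups\<close>

definition real_linear_algebraic_group :: "(real^'n^'n) set \<Rightarrow> bool" where
  "real_linear_algebraic_group G \<longleftrightarrow>
     mat 1 \<in> G \<and> (\<forall>g\<in>G. \<forall>h\<in>G. g ** h \<in> G) \<and> (\<forall>g\<in>G. matrix_inv g \<in> G) \<and>
     (\<exists>Z. algebraic_set Z \<and> G = {g. invertible g} \<inter> Z)"

text \<open>
  The multiplication \<open>*\<close> on the vector type is componentwise, so \<^const>\<open>exp\<close> is not the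
  matrix exponential.
\<close>

definition matrix_exp :: "real^'n^'n \<Rightarrow> real^'n^'n" where
  "matrix_exp A = (\<Sum>k. (1 / fact k) *\<^sub>R (((**) A ^^ k) (mat 1)))"

definition lie_algebra :: "(real^'n^'n) set \<Rightarrow> (real^'n^'n) set" where
  "lie_algebra G = {X. \<forall>t. matrix_exp (t *\<^sub>R X) \<in> G}"


section \<open>Analytic maps from a matrix group to a Banach space of functions\<close>

definition multi_indices :: "'b set \<Rightarrow> ('b \<Rightarrow> nat) set" where
  "multi_indices E = {\<alpha>. \<forall>b. b \<notin> E \<longrightarrow> \<alpha> b = 0}"

text \<open>
  The Banach space is given by a carrier \<open>B\<close>, a linear space of complex functions, and a norm
  \<open>N\<close> on it. The analytic structure of a closed subgroup \<open>G\<close> of the general linear group is the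
  one given by the canonical coordinates \<open>(t\<^sub>b) \<mapsto> g exp (\<Sum> t\<^sub>b b)\<close> of the first kind around
  each \<open>g\<close>, where \<open>b\<close> ranges over a basis \<open>E\<close> of the Lie algebra (a linear subspace, since \<open>G\<close>
  is closed; the choice of basis is immaterial). A map is analytic if near each \<open>g\<close> it is, in
  these coordinates, the sum of a power series with coefficients in \<open>B\<close> that converges
  unconditionally with respect to \<open>N\<close>.
\<close>

definition analytic_map ::
  "(real^'n^'n) set \<Rightarrow> ('x \<Rightarrow> complex) set \<Rightarrow> (('x \<Rightarrow> complex) \<Rightarrow> real) \<Rightarrow>
   (real^'n^'n \<Rightarrow> 'x \<Rightarrow> complex) \<Rightarrow> bool" where
  "analytic_map G B N f \<longleftrightarrow>
     (\<forall>g\<in>G. f g \<in> B) \<and>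
     (\<forall>g\<in>G. \<forall>E. independent E \<and> span E = lie_algebra G \<longrightarrow>
       (\<exists>\<epsilon>>0. \<exists>c. (\<forall>\<alpha>\<in>multi_indices E. c \<alpha> \<in> B) \<and>
         (\<forall>t. (\<forall>b\<in>E. \<bar>t b\<bar> < \<epsilon>) \<longrightarrow>
           ((\<lambda>A. N (\<lambda>x. f (g ** matrix_exp (\<Sum>b\<in>E. t b *\<^sub>R b)) x -
                      (\<Sum>\<alpha>\<in>A. of_real (\<Prod>b\<in>E. t b ^ \<alpha> b) * c \<alpha> x)))
             \<longlongrightarrow> 0) (finite_subsets_at_top (multi_indices E)))))"

definition analytic_vector ::
  "(real^'n^'n) set \<Rightarrow> ('x \<Rightarrow> complex) set \<Rightarrow> (('x \<Rightarrow> complex) \<Rightarrow> real) \<Rightarrow>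
   (real^'n^'n \<Rightarrow> ('x \<Rightarrow> complex) \<Rightarrow> ('x \<Rightarrow> complex)) \<Rightarrow> ('x \<Rightarrow> complex) \<Rightarrow> bool" where
  "analytic_vector G B N \<pi> \<phi> \<longleftrightarrow> \<phi> \<in> B \<and> analytic_map G B N (\<lambda>g. \<pi> g \<phi>)"


section \<open>The left regular representation\<close>

text \<open>
  A function on \<open>M\<close> is encoded as a function on the ambient space that is zero off \<open>M\<close>.
\<close>

definition C0 :: "'a::topological_space set \<Rightarrow> ('a \<Rightarrow> complex) set" where
  "C0 M = {\<phi>. (\<forall>m. m \<notin> M \<longrightarrow> \<phi> m = 0) \<and> continuous_on M \<phi> \<and>
     (\<forall>e>0. \<exists>K. compact K \<and> K \<subseteq> M \<and> (\<forall>m\<in>M - K. cmod (\<phi> m) < e))}"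

text \<open>The inserted \<open>0\<close> matters only for empty \<open>M\<close>.\<close>

definition sup_norm :: "'a set \<Rightarrow> ('a \<Rightarrow> complex) \<Rightarrow> real" where
  "sup_norm M \<phi> = Sup (insert 0 ((\<lambda>m. cmod (\<phi> m)) ` M))"

text \<open>
  If \<open>M\<close> is stable under the group, this preserves the functions that are zero off \<open>M\<close>.
\<close>

definition left_regular :: "real^'n^'n \<Rightarrow> (real^'n \<Rightarrow> complex) \<Rightarrow> (real^'n \<Rightarrow> complex)" where
  "left_regular g \<phi> = (\<lambda>m. \<phi> (matrix_inv g *v m))"

definition coordinate_ring :: "'a::real_normed_vector set \<Rightarrow> ('a \<Rightarrow> complex) set" where
  "coordinate_ring M = {\<lambda>m. if m \<in> M then p m else 0 | p. polynomial_function p}"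

definition gaussian_polynomials :: "(real^'n) set \<Rightarrow> (real^'n \<Rightarrow> complex) set" where
  "gaussian_polynomials M =
     {\<lambda>m. f m * of_real (exp (- (\<Sum>i\<in>UNIV. (m $ i)\<^sup>2))) | f. f \<in> coordinate_ring M}"

end

theory Submission
  imports Defs
begin

text \<open>
  In the coordinates \<open>t\<close> around \<open>g\<close>, and with \<open>u = g\<inverse> m\<close>, the orbit map sends \<open>t\<close> to
  \<open>p (Y u) exp (- |Y u|\<^sup>2)\<close>, where \<open>Y = exp (- \<Sum> t\<^sub>b b)\<close>. Since \<open>Y\<close> is near the identity,
  \<open>|Y u|\<^sup>2 = |u|\<^sup>2 + q\<close>, where the power series of \<open>q\<close> in \<open>t\<close> is majorized by a small multiple of
  \<open>|u|\<^sup>2\<close>. So the series of \<open>exp (- q)\<close> is majorized by \<open>exp (|u|\<^sup>2 / 4)\<close>, the coefficients of the whole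
  series are dominated by \<open>(1 + |u|)\<^sup>d exp (|u|\<^sup>2 / 4 - |u|\<^sup>2)\<close>, which vanishes at infinity, and the
  series converges in the supremum norm.
\<close>

section \<open>Weighted majorants for power series with continuous coefficients\<close>

text \<open>The factors cannot be handled one by one as power series with values in
  \<open>C0 M\<close>: on an unbounded \<open>M\<close> neither a polynomial nor
  \<open>exp (- q)\<close> need vanish at infinity, only the product with the Gaussian is known to.
  The predicate below therefore separates the two variables: every term is bounded by a number
  \<open>A i\<close> times one weight \<open>w u\<close>, and the numbers have total at most
  \<open>C\<close>. Weights may grow; under products both weights and totals multiply, so growth
  meets decay only in the final weight. The radius \<open>r\<close> is critical only for the
  exponential. There the factorials are spent on replacing \<open>w ^ k\<close> by
  \<open>exp w\<close>, and a geometric series remains, whose ratio has to be made small.\<close>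

text \<open>
  The terms are indexed by natural numbers, with repeated monomials allowed, so that products and
  infinite sums need no regrouping; the regrouping by multi-indices is done once, at the end.
\<close>

definition majorized ::
  "'b set \<Rightarrow> real \<Rightarrow> ('a::topological_space \<Rightarrow> real) \<Rightarrow> real \<Rightarrow> (('b \<Rightarrow> real) \<Rightarrow> 'a \<Rightarrow> complex) \<Rightarrow> bool" where
  "majorized E r w C f \<longleftrightarrow> (\<forall>u. 0 \<le> w u) \<and> (\<exists>c \<mu> A.
     (\<forall>i::nat. \<mu> i \<in> multi_indices E \<and> continuous_on UNIV (c i) \<and> 0 \<le> A i \<and>
        (\<forall>u. cmod (c i u) * r ^ (\<Sum>b\<in>E. \<mu> i b) \<le> A i * w u)) \<and>
     (\<forall>F. finite F \<longrightarrow> sum A F \<le> C) \<and>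
     (\<forall>t u. (\<forall>b\<in>E. \<bar>t b\<bar> \<le> r) \<longrightarrow>
        ((\<lambda>i. of_real (\<Prod>b\<in>E. t b ^ \<mu> i b) * c i u) has_sum f t u) UNIV))"

lemma majorizedI:
  assumes "\<And>u. 0 \<le> w u" "\<And>i::nat. \<mu> i \<in> multi_indices E" "\<And>i. continuous_on UNIV (c i)"
    "\<And>i. 0 \<le> A i" "\<And>i u. cmod (c i u) * r ^ (\<Sum>b\<in>E. \<mu> i b) \<le> A i * w u"
    "\<And>F. finite F \<Longrightarrow> sum A F \<le> C"
    "\<And>t u. (\<forall>b\<in>E. \<bar>t b\<bar> \<le> r) \<Longrightarrow>
        ((\<lambda>i. of_real (\<Prod>b\<in>E. t b ^ \<mu> i b) * c i u) has_sum f t u) UNIV"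
  shows "majorized E r w C f"
  unfolding majorized_def
  by (intro conjI allI impI exI[of _ c] exI[of _ \<mu>] exI[of _ A]; fact | rule assms; simp)

lemma majorizedE:
  assumes "majorized E r w C f"
  obtains \<mu> c A where "\<And>i::nat. \<mu> i \<in> multi_indices E" "\<And>i. continuous_on UNIV (c i)"
    "\<And>i. 0 \<le> A i" "\<And>i u. cmod (c i u) * r ^ (\<Sum>b\<in>E. \<mu> i b) \<le> A i * w u"
    "\<And>F. finite F \<Longrightarrow> sum A F \<le> C"
    "\<And>t u. (\<forall>b\<in>E. \<bar>t b\<bar> \<le> r) \<Longrightarrow>
        ((\<lambda>i. of_real (\<Prod>b\<in>E. t b ^ \<mu> i b) * c i u) has_sum f t u) UNIV"
  using assms unfolding majorized_def by (elim conjE exE) blast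

lemma majorized_nonneg:
  assumes "majorized E r w C f" shows "0 \<le> C" "0 \<le> w u"
  using assms unfolding majorized_def by (auto dest!: spec[of _ "{}"])

lemma majorized_cong:
  assumes "majorized E r w C f"
    and "\<And>t u. (\<forall>b\<in>E. \<bar>t b\<bar> \<le> r) \<Longrightarrow> f t u = g t u"
  shows "majorized E r w C g"
  using assms unfolding majorized_def by simp

lemma majorized_mono:
  assumes "majorized E r w C f" "C \<le> D"
  shows "majorized E r w D f"
proof -
  obtain \<mu> c A where *: "\<And>i::nat. \<mu> i \<in> multi_indices E" "\<And>i. continuous_on UNIV (c i)"
    "\<And>i. 0 \<le> A i" "\<And>i u. cmod (c i u) * r ^ (\<Sum>b\<in>E. \<mu> i b) \<le> A i * w u"
    "\<And>F. finite F \<Longrightarrow> sum A F \<le> C"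
    "\<And>t u. (\<forall>b\<in>E. \<bar>t b\<bar> \<le> r) \<Longrightarrow>
        ((\<lambda>i. of_real (\<Prod>b\<in>E. t b ^ \<mu> i b) * c i u) has_sum f t u) UNIV"
    by (rule majorizedE[OF assms(1)]) (rule that)
  show ?thesis
    by (rule majorizedI[OF majorized_nonneg(2)[OF assms(1)] *(1-4) order_trans[OF *(5) assms(2)] *(6)])
qed

text \<open>Constants move freely between weight and total. This is how powers of \<open>w\<close>
  are traded for \<open>exp w\<close>, and how the weight of \<open>q\<close> gets its factor 1/4 at
  the price of a factor 4 in the total.\<close>

lemma majorized_weight:
  assumes f: "majorized E r w C f" and K: "0 \<le> K" "\<And>u. w u \<le> K * w' u" "\<And>u. 0 \<le> w' u"
  shows "majorized E r w' (K * C) f"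
proof -
  obtain \<mu> c A where *: "\<And>i::nat. \<mu> i \<in> multi_indices E" "\<And>i. continuous_on UNIV (c i)"
    "\<And>i. 0 \<le> A i" "\<And>i u. cmod (c i u) * r ^ (\<Sum>b\<in>E. \<mu> i b) \<le> A i * w u"
    "\<And>F. finite F \<Longrightarrow> sum A F \<le> C"
    "\<And>t u. (\<forall>b\<in>E. \<bar>t b\<bar> \<le> r) \<Longrightarrow>
        ((\<lambda>i. of_real (\<Prod>b\<in>E. t b ^ \<mu> i b) * c i u) has_sum f t u) UNIV"
    by (rule majorizedE[OF f]) (rule that)
  have "cmod (c i u) * r ^ (\<Sum>b\<in>E. \<mu> i b) \<le> (K * A i) * w' u" for i u
  proof -
    have "A i * w u \<le> A i * (K * w' u)" using * K by (intro mult_left_mono) auto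
    then show ?thesis using *(4)[of i u] by (simp add: mult_ac)
  qed
  moreover have "(\<Sum>i\<in>F. K * A i) \<le> K * C" if "finite F" for F
    using *(5)[OF that] K by (simp add: sum_distrib_left[symmetric] mult_left_mono)
  ultimately show ?thesis
    using * K by (intro majorizedI[of w' \<mu> E c "\<lambda>i. K * A i" r]) auto
qed

section \<open>Pointwise bounds from a majorant\<close>

lemma abs_monomial_le:
  assumes "\<forall>b\<in>E. \<bar>t b\<bar> \<le> (r::real)"
  shows "\<bar>\<Prod>b\<in>E. t b ^ \<alpha> b\<bar> \<le> r ^ (\<Sum>b\<in>E. \<alpha> b)"
proof -
  have "\<bar>\<Prod>b\<in>E. t b ^ \<alpha> b\<bar> = (\<Prod>b\<in>E. \<bar>t b\<bar> ^ \<alpha> b)"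
    by (simp add: abs_prod power_abs)
  also have "\<dots> \<le> (\<Prod>b\<in>E. r ^ \<alpha> b)"
    using assms by (intro prod_mono) (auto intro!: power_mono)
  finally show ?thesis by (simp add: power_sum)
qed

lemma monomial_term_le:
  assumes "\<forall>b\<in>E. \<bar>t b\<bar> \<le> (r::real)" "cmod c * r ^ (\<Sum>b\<in>E. \<alpha> b) \<le> B"
  shows "cmod (of_real (\<Prod>b\<in>E. t b ^ \<alpha> b) * c) \<le> B"
proof -
  have "cmod (of_real (\<Prod>b\<in>E. t b ^ \<alpha> b) * c) = cmod c * \<bar>\<Prod>b\<in>E. t b ^ \<alpha> b\<bar>"
    by (simp add: norm_mult mult.commute del: of_real_prod of_real_power)
  also have "\<dots> \<le> cmod c * r ^ (\<Sum>b\<in>E. \<alpha> b)"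
    using abs_monomial_le[OF assms(1)] by (intro mult_left_mono) auto
  finally show ?thesis using assms by simp
qed

text \<open>Finite partial sums obey the bound, so their limit does. With no coordinates at all
  (\<open>E = {}\<close>) this turns a majorant into a plain growth bound for a function of
  \<open>u\<close>.\<close>

lemma majorized_norm_le:
  assumes f: "majorized E r w C f" and t: "\<forall>b\<in>E. \<bar>t b\<bar> \<le> r"
  shows "cmod (f t u) \<le> C * w u"
proof -
  obtain \<mu> c A where *: "\<And>i::nat. \<mu> i \<in> multi_indices E" "\<And>i. continuous_on UNIV (c i)"
    "\<And>i. 0 \<le> A i" "\<And>i u. cmod (c i u) * r ^ (\<Sum>b\<in>E. \<mu> i b) \<le> A i * w u"
    "\<And>F. finite F \<Longrightarrow> sum A F \<le> C"
    "\<And>t u. (\<forall>b\<in>E. \<bar>t b\<bar> \<le> r) \<Longrightarrow>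
        ((\<lambda>i. of_real (\<Prod>b\<in>E. t b ^ \<mu> i b) * c i u) has_sum f t u) UNIV"
    by (rule majorizedE[OF f]) (rule that)
  have "((\<lambda>F. \<Sum>i\<in>F. of_real (\<Prod>b\<in>E. t b ^ \<mu> i b) * c i u) \<longlongrightarrow> f t u) (finite_subsets_at_top UNIV)"
    using *(6)[OF t] by (simp add: has_sum_def)
  then have "((\<lambda>F. cmod (\<Sum>i\<in>F. of_real (\<Prod>b\<in>E. t b ^ \<mu> i b) * c i u)) \<longlongrightarrow> cmod (f t u)) (finite_subsets_at_top UNIV)"
    by (rule tendsto_norm)
  then show ?thesis
  proof (rule tendsto_upperbound)
    have "cmod (\<Sum>i\<in>F. of_real (\<Prod>b\<in>E. t b ^ \<mu> i b) * c i u) \<le> C * w u" if "finite F" for F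
    proof -
      have "cmod (\<Sum>i\<in>F. of_real (\<Prod>b\<in>E. t b ^ \<mu> i b) * c i u) \<le> (\<Sum>i\<in>F. A i * w u)"
        by (intro sum_norm_le monomial_term_le[OF t] *)
      also have "\<dots> \<le> C * w u"
        unfolding sum_distrib_right[symmetric]
        using *(5)[OF that] majorized_nonneg(2)[OF f] by (rule mult_right_mono)
      finally show ?thesis .
    qed
    then show "\<forall>\<^sub>F F in finite_subsets_at_top UNIV. cmod (\<Sum>i\<in>F. of_real (\<Prod>b\<in>E. t b ^ \<mu> i b) * c i u) \<le> C * w u"
      by (auto intro!: eventually_finite_subsets_at_top_weakI)
  qed simp
qed

section \<open>Products and infinite sums of majorized series\<close>

lemma majorized_monomial_mult:
  assumes g: "majorized E r w' D g" and \<alpha>: "\<alpha> \<in> multi_indices E"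
    and c: "continuous_on UNIV c" "\<And>u. cmod (c u) * r ^ (\<Sum>b\<in>E. \<alpha> b) \<le> a * w u"
    and w: "\<And>u. 0 \<le> w u" "0 \<le> a"
    and r: "0 \<le> r"
  shows "majorized E r (\<lambda>u. w u * w' u) (a * D) (\<lambda>t u. of_real (\<Prod>b\<in>E. t b ^ \<alpha> b) * c u * g t u)"
proof -
  obtain \<mu> c' A where *: "\<And>i::nat. \<mu> i \<in> multi_indices E" "\<And>i. continuous_on UNIV (c' i)"
    "\<And>i. 0 \<le> A i" "\<And>i u. cmod (c' i u) * r ^ (\<Sum>b\<in>E. \<mu> i b) \<le> A i * w' u"
    "\<And>F. finite F \<Longrightarrow> sum A F \<le> D"
    "\<And>t u. (\<forall>b\<in>E. \<bar>t b\<bar> \<le> r) \<Longrightarrow>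
        ((\<lambda>i. of_real (\<Prod>b\<in>E. t b ^ \<mu> i b) * c' i u) has_sum g t u) UNIV"
    by (rule majorizedE[OF g]) (rule that)
  have 1: "(\<lambda>b. \<alpha> b + \<mu> i b) \<in> multi_indices E" for i
    using \<alpha> *(1)[of i] by (auto simp: multi_indices_def)
  have 2: "cmod (c u * c' i u) * r ^ (\<Sum>b\<in>E. \<alpha> b + \<mu> i b) \<le> (a * A i) * (w u * w' u)" for i u
  proof -
    have "cmod (c u * c' i u) * r ^ (\<Sum>b\<in>E. \<alpha> b + \<mu> i b) =
      (cmod (c u) * r ^ (\<Sum>b\<in>E. \<alpha> b)) * (cmod (c' i u) * r ^ (\<Sum>b\<in>E. \<mu> i b))"
      by (simp add: norm_mult sum.distrib power_add mult_ac)
    also have "\<dots> \<le> (a * w u) * (A i * w' u)"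
      using r w by (intro mult_mono[OF c(2) *(4)]) auto
    finally show ?thesis by (simp add: mult_ac)
  qed
  have 3: "(\<Sum>i\<in>F. a * A i) \<le> a * D" if "finite F" for F
    using *(5)[OF that] w by (simp add: sum_distrib_left[symmetric] mult_left_mono)
  have 4: "((\<lambda>i. of_real (\<Prod>b\<in>E. t b ^ (\<alpha> b + \<mu> i b)) * (c u * c' i u)) has_sum
       of_real (\<Prod>b\<in>E. t b ^ \<alpha> b) * c u * g t u) UNIV" if "\<forall>b\<in>E. \<bar>t b\<bar> \<le> r" for t u
  proof -
    have "((\<lambda>i. (of_real (\<Prod>b\<in>E. t b ^ \<alpha> b) * c u) * (of_real (\<Prod>b\<in>E. t b ^ \<mu> i b) * c' i u)) has_sum
       of_real (\<Prod>b\<in>E. t b ^ \<alpha> b) * c u * g t u) UNIV"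
      by (rule has_sum_cmult_right[OF *(6)[OF that]])
    then show ?thesis by (simp add: power_add prod.distrib mult_ac)
  qed
  show ?thesis
  proof (rule majorizedI[OF _ 1 _ _ 2 3 4])
  qed (use w * majorized_nonneg(2)[OF g] in \<open>auto intro!: continuous_intros c\<close>)
qed

lemma majorized_one: "majorized E r (\<lambda>_. 1) 1 (\<lambda>_ _. 1)"
proof -
  \<comment> \<open>Terms are indexed by all naturals, so a single term is padded: every later one
    has coefficient and bound 0.\<close>
  have "((\<lambda>i. of_bool (i = (0::nat))) has_sum (1::complex)) UNIV"
    by (rule has_sum_finite_neutralI[of "{0}"]) auto
  then show ?thesis
    by (intro majorizedI[where \<mu> = "\<lambda>i b. 0" and c = "\<lambda>i u. of_bool (i = 0)" and A = "\<lambda>i. of_bool (i = 0)"])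
      (auto simp: multi_indices_def intro: order_trans[OF card_mono[of "{0}"]])
qed

lemma majorized_monomial:
  assumes "\<alpha> \<in> multi_indices E" "continuous_on UNIV c"
    "\<And>u. cmod (c u) * r ^ (\<Sum>b\<in>E. \<alpha> b) \<le> a * w u" "\<And>u. 0 \<le> w u" "0 \<le> a" "0 \<le> r"
  shows "majorized E r w a (\<lambda>t u. of_real (\<Prod>b\<in>E. t b ^ \<alpha> b) * c u)"
  using majorized_monomial_mult[OF majorized_one assms] by simp

lemma majorized_const:
  assumes "continuous_on UNIV c" "\<And>u. cmod (c u) \<le> a * w u" "\<And>u. 0 \<le> w u" "0 \<le> a" "0 \<le> r"
  shows "majorized E r w a (\<lambda>t. c)"
  using majorized_monomial[of "\<lambda>_. 0" E c r a w] assms by (simp add: multi_indices_def)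

lemma majorized_coordinate:
  assumes "finite E" "b \<in> E" "0 \<le> r"
  shows "majorized E r (\<lambda>_. 1) (\<bar>x\<bar> * r) (\<lambda>t u. of_real (t b * x))"
proof -
  let ?\<alpha> = "\<lambda>b'. of_bool (b' = b) :: nat"
  have s: "sum ?\<alpha> E = 1" using assms by (simp add: of_bool_def sum.delta)
  have p: "(\<Prod>b'\<in>E. t b' ^ ?\<alpha> b') = t b" for t :: "_ \<Rightarrow> real"
  proof -
    have "(\<Prod>b'\<in>E. t b' ^ ?\<alpha> b') = (\<Prod>b'\<in>E. if b' = b then t b' else 1)"
      by (intro prod.cong) auto
    then show ?thesis using assms by (simp add: prod.delta)
  qed
  have "majorized E r (\<lambda>_. 1) (\<bar>x\<bar> * r) (\<lambda>t u. of_real (\<Prod>b'\<in>E. t b' ^ ?\<alpha> b') * of_real x)"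
    using assms s by (intro majorized_monomial) (auto simp: multi_indices_def)
  then show ?thesis unfolding p by simp
qed

lemma choice3:
  assumes "\<forall>k. \<exists>a b c. P k a b c"
  shows "\<exists>a b c. \<forall>k. P k (a k) (b k) (c k)"
  using assms by metis

text \<open>The closure properties below rest on this one: products, finite sums and exponentials
  are all countable sums of simpler series. The doubly indexed terms converge absolutely because
  their bounds have total at most \<open>S\<close>, and Fubini identifies the value.\<close>

lemma majorized_has_sum:
  assumes f: "\<And>k::nat. majorized E r w (C k) (f k)" and C: "(C has_sum S) UNIV"
    and F: "\<And>t u. \<forall>b\<in>E. \<bar>t b\<bar> \<le> r \<Longrightarrow> ((\<lambda>k. f k t u) has_sum F t u) UNIV"
  shows "majorized E r w S F"
proof -
  have "\<forall>k. \<exists>c \<mu> A.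
     (\<forall>i::nat. \<mu> i \<in> multi_indices E \<and> continuous_on UNIV (c i) \<and> 0 \<le> A i \<and>
        (\<forall>u. cmod (c i u) * r ^ (\<Sum>b\<in>E. \<mu> i b) \<le> A i * w u)) \<and>
     (\<forall>F. finite F \<longrightarrow> sum A F \<le> C k) \<and>
     (\<forall>t u. (\<forall>b\<in>E. \<bar>t b\<bar> \<le> r) \<longrightarrow>
        ((\<lambda>i. of_real (\<Prod>b\<in>E. t b ^ \<mu> i b) * c i u) has_sum f k t u) UNIV)"
    using f unfolding majorized_def by blast
  then obtain \<mu> c A where *: "\<And>k.
     (\<forall>i::nat. \<mu> k i \<in> multi_indices E \<and> continuous_on UNIV (c k i) \<and> 0 \<le> A k i \<and>
        (\<forall>u. cmod (c k i u) * r ^ (\<Sum>b\<in>E. \<mu> k i b) \<le> A k i * w u)) \<and>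
     (\<forall>F. finite F \<longrightarrow> sum (A k) F \<le> C k) \<and>
     (\<forall>t u. (\<forall>b\<in>E. \<bar>t b\<bar> \<le> r) \<longrightarrow>
        ((\<lambda>i. of_real (\<Prod>b\<in>E. t b ^ \<mu> k i b) * c k i u) has_sum f k t u) UNIV)"
    by (elim choice3[THEN exE] exE) (rule that, erule spec)
  have w: "0 \<le> w u" for u using majorized_nonneg[OF f] by blast
  have C0: "0 \<le> C k" for k using majorized_nonneg[OF f] by blast
  define A' where "A' = (\<lambda>(k, i). A k i)"
  have A'0: "0 \<le> A' p" for p using * by (auto simp: A'_def split: prod.splits)
  have A'S: "sum A' P \<le> S" if "finite P" for P
  proof -
    \<comment> \<open>Enlarging \<open>P\<close> to a rectangle lets the bounds \<open>C k\<close>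
      be applied row by row.\<close>
    have "sum A' P \<le> sum A' (fst ` P \<times> snd ` P)"
      using that A'0 by (intro sum_mono2) force+
    also have "\<dots> = (\<Sum>k\<in>fst ` P. \<Sum>i\<in>snd ` P. A k i)"
      by (simp add: sum.cartesian_product A'_def)
    also have "\<dots> \<le> (\<Sum>k\<in>fst ` P. C k)"
      using * that by (intro sum_mono) auto
    also have "\<dots> \<le> S"
      using finite_sum_le_has_sum[OF C, of "fst ` P"] C0 that by auto
    finally show ?thesis .
  qed
  have sA': "A' summable_on UNIV"
    by (rule nonneg_bdd_above_summable_on) (auto intro!: A'0 bdd_aboveI2 A'S)
  have sum: "((\<lambda>p. of_real (\<Prod>b\<in>E. t b ^ \<mu> (fst p) (snd p) b) * c (fst p) (snd p) u) has_sum F t u) UNIV"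
    (is "(?h has_sum _) _")
    if t: "\<forall>b\<in>E. \<bar>t b\<bar> \<le> r" for t u
  proof -
    have "cmod (?h p) \<le> A' p * w u" for p
      using monomial_term_le[OF t] * by (auto simp: A'_def split: prod.splits)
    moreover have "(\<lambda>p. A' p * w u) summable_on UNIV"
      by (rule summable_on_cmult_left[OF sA'])
    ultimately have "(\<lambda>p. cmod (?h p)) summable_on UNIV"
      by (intro Infinite_Sum.abs_summable_on_comparison_test'[of "\<lambda>p. A' p * w u"]) auto
    then have "?h summable_on UNIV" by (rule abs_summable_summable)
    then have H: "(?h has_sum infsum ?h UNIV) (UNIV \<times> UNIV)"
      by simp
    \<comment> \<open>Summing the inner index first gives \<open>f k t u\<close>, so uniqueness of
      sums identifies the double sum with \<open>F t u\<close>.\<close>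
    have "((\<lambda>k. f k t u) has_sum infsum ?h UNIV) UNIV"
      by (rule has_sum_SigmaD[OF H]) (use * t in auto)
    then have "infsum ?h UNIV = F t u"
      using F[OF t, of u] by (rule has_sum_unique)
    then show ?thesis
      using H by simp
  qed
  \<comment> \<open>The pairing bijection brings the double index back to one natural
    number.\<close>
  show ?thesis
  proof (rule majorizedI[where c = "\<lambda>n. c (fst (prod_decode n)) (snd (prod_decode n))"
      and \<mu> = "\<lambda>n. \<mu> (fst (prod_decode n)) (snd (prod_decode n))" and A = "\<lambda>n. A' (prod_decode n)"])
    fix G :: "nat set" assume "finite G"
    then have "sum A' (prod_decode ` G) \<le> S" by (intro A'S) auto
    then show "(\<Sum>n\<in>G. A' (prod_decode n)) \<le> S"
      by (simp add: sum.reindex inj_prod_decode)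
  next
    fix t :: "_ \<Rightarrow> real" and u assume "\<forall>b\<in>E. \<bar>t b\<bar> \<le> r"
    from sum[OF this, of u] show "((\<lambda>n. of_real (\<Prod>b\<in>E. t b ^ \<mu> (fst (prod_decode n)) (snd (prod_decode n)) b) *
               c (fst (prod_decode n)) (snd (prod_decode n)) u) has_sum F t u) UNIV"
      by (subst has_sum_reindex_bij_betw[OF bij_prod_decode])
  qed (use * w A'0 in \<open>auto simp: A'_def split: prod.splits\<close>)
qed

text \<open>Only \<open>f\<close> is expanded: the product is a countable sum of single monomial
  terms times \<open>g\<close>, so no Cauchy product of the two series has to be formed.\<close>

lemma majorized_mult:
  assumes f: "majorized E r w C f" and g: "majorized E r w' D g" and r: "0 \<le> r"
  shows "majorized E r (\<lambda>u. w u * w' u) (C * D) (\<lambda>t u. f t u * g t u)"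
proof -
  obtain \<mu> c A where *: "\<And>i::nat. \<mu> i \<in> multi_indices E" "\<And>i. continuous_on UNIV (c i)"
    "\<And>i. 0 \<le> A i" "\<And>i u. cmod (c i u) * r ^ (\<Sum>b\<in>E. \<mu> i b) \<le> A i * w u"
    "\<And>F. finite F \<Longrightarrow> sum A F \<le> C"
    "\<And>t u. (\<forall>b\<in>E. \<bar>t b\<bar> \<le> r) \<Longrightarrow>
        ((\<lambda>i. of_real (\<Prod>b\<in>E. t b ^ \<mu> i b) * c i u) has_sum f t u) UNIV"
    by (rule majorizedE[OF f]) (rule that)
  \<comment> \<open>\<open>C\<close> merely bounds the total of \<open>A\<close>, whereas summing a
    family needs totals with an exact sum. Hence \<open>infsum A UNIV\<close> comes first, and
    \<open>C\<close> by monotonicity at the end.\<close>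
  have "A summable_on UNIV"
    by (rule nonneg_bdd_above_summable_on) (auto intro!: * bdd_aboveI2)
  then have A: "(A has_sum infsum A UNIV) UNIV" and "infsum A UNIV \<le> C"
    using * by (auto intro!: infsum_le_finite_sums)
  have "majorized E r (\<lambda>u. w u * w' u) (infsum A UNIV * D) (\<lambda>t u. f t u * g t u)"
  proof (rule majorized_has_sum[where f = "\<lambda>i t u. of_real (\<Prod>b\<in>E. t b ^ \<mu> i b) * c i u * g t u"])
    show "majorized E r (\<lambda>u. w u * w' u) (A i * D)
       (\<lambda>t u. of_real (\<Prod>b\<in>E. t b ^ \<mu> i b) * c i u * g t u)" for i
      by (intro majorized_monomial_mult g * r majorized_nonneg[OF f])
  qed (rule has_sum_cmult_left[OF A], rule has_sum_cmult_left[OF *(6)])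
  then show ?thesis
    using \<open>infsum A UNIV \<le> C\<close> majorized_nonneg(1)[OF g]
    by (auto intro: majorized_mono mult_right_mono)
qed

lemma majorized_sum:
  assumes "\<And>k. k \<in> I \<Longrightarrow> majorized E r w (C k) (f k)" "finite I" and w: "\<And>u. 0 \<le> w u" "0 \<le> r"
  shows "majorized E r w (sum C I) (\<lambda>t u. \<Sum>k\<in>I. f k t u)"
  using assms(2,1)
proof (induction I rule: finite_induct)
  case empty
  show ?case using w by (auto intro!: majorized_const)
next
  case (insert x I)
  \<comment> \<open>The binary sum is presented as a sequence that vanishes from index 2 on.\<close>
  let ?f = "\<lambda>n t u. if n = 0 then f x t u else if n = Suc 0 then \<Sum>k\<in>I. f k t u else 0"
  let ?C = "\<lambda>n. if n = 0 then C x else if n = Suc 0 then sum C I else 0"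
  have z: "majorized E r w 0 (\<lambda>t u. 0)" using w by (auto intro!: majorized_const)
  show ?case
  proof (rule majorized_has_sum[where C = ?C and f = ?f])
    show "majorized E r w (?C k) (?f k)" for k
      using insert z by auto
    show "(?C has_sum sum C (insert x I)) UNIV"
      by (rule has_sum_finite_neutralI[of "{0, Suc 0}"]) (use insert in auto)
    show "((\<lambda>k. ?f k t u) has_sum (\<Sum>k\<in>insert x I. f k t u)) UNIV" for t u
      by (rule has_sum_finite_neutralI[of "{0, Suc 0}"]) (use insert in auto)
  qed
qed

lemma majorized_add:
  assumes "majorized E r w C f" "majorized E r w D g" "0 \<le> r"
  shows "majorized E r w (C + D) (\<lambda>t u. f t u + g t u)"
proof -
  have "majorized E r w (\<Sum>k\<in>(UNIV::bool set). if k then C else D)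
    (\<lambda>t u. \<Sum>k\<in>(UNIV::bool set). (if k then f else g) t u)"
    using assms majorized_nonneg[OF assms(1)] by (intro majorized_sum) auto
  then show ?thesis by (simp add: UNIV_bool add.commute)
qed

lemma majorized_power:
  assumes f: "majorized E r w C f" and r: "0 \<le> r"
  shows "majorized E r (\<lambda>u. w u ^ k) (C ^ k) (\<lambda>t u. f t u ^ k)"
proof (induction k)
  case (Suc k)
  show ?case using majorized_mult[OF f Suc r] by simp
qed (simp add: majorized_one)

lemma majorized_cmult:
  assumes "majorized E r w C f" "0 \<le> r"
  shows "majorized E r w (cmod x * C) (\<lambda>t u. x * f t u)"
  using majorized_mult[OF majorized_const[of "\<lambda>_. x" "cmod x" "\<lambda>_. 1" r E] assms(1)] assms(2) by simp

text \<open>Terms sharing a multi-index are collected over the fibres of \<open>\<mu>\<close>. A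
  fibre may be infinite, so each new coefficient is itself the sum of a series, and its continuity
  has to be proved by uniform convergence.\<close>

lemma majorized_power_series:
  fixes w :: "'a::t2_space \<Rightarrow> real"
  assumes f: "majorized E r w C f" and w: "continuous_on UNIV w" and r: "0 < r"
  obtains c a where
    "\<And>\<alpha>. continuous_on UNIV (c \<alpha>)"
    "\<And>\<alpha> u. cmod (c \<alpha> u) * r ^ (\<Sum>b\<in>E. \<alpha> b) \<le> a \<alpha> * w u"
    "a summable_on multi_indices E"
    "\<And>t u. (\<forall>b\<in>E. \<bar>t b\<bar> \<le> r) \<Longrightarrow>
        ((\<lambda>\<alpha>. of_real (\<Prod>b\<in>E. t b ^ \<alpha> b) * c \<alpha> u) has_sum f t u) (multi_indices E)"
proof -
  obtain \<mu> c A where *: "\<And>i::nat. \<mu> i \<in> multi_indices E" "\<And>i. continuous_on UNIV (c i)"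
    "\<And>i. 0 \<le> A i" "\<And>i u. cmod (c i u) * r ^ (\<Sum>b\<in>E. \<mu> i b) \<le> A i * w u"
    "\<And>F. finite F \<Longrightarrow> sum A F \<le> C"
    "\<And>t u. (\<forall>b\<in>E. \<bar>t b\<bar> \<le> r) \<Longrightarrow>
        ((\<lambda>i. of_real (\<Prod>b\<in>E. t b ^ \<mu> i b) * c i u) has_sum f t u) UNIV"
    by (rule majorizedE[OF f]) (rule that)
  define I where "I \<alpha> = {i. \<mu> i = \<alpha>}" for \<alpha>
  define d where "d \<alpha> u = (\<Sum>\<^sub>\<infinity>i\<in>I \<alpha>. c i u)" for \<alpha> u
  define a where "a \<alpha> = infsum A (I \<alpha>)" for \<alpha>
  \<comment> \<open>Each index lies in exactly one fibre, so pairing it with its multi-index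
    reindexes the series without repetition.\<close>
  have bij: "bij_betw (\<lambda>i. (\<mu> i, i)) UNIV (Sigma (multi_indices E) I)"
    using *(1) by (auto simp: bij_betw_def inj_on_def I_def)
  have A: "A summable_on UNIV"
    by (rule nonneg_bdd_above_summable_on) (auto intro!: * bdd_aboveI2)
  then have AI: "(A has_sum a \<alpha>) (I \<alpha>)" for \<alpha>
    unfolding a_def by (intro has_sum_infsum summable_on_subset_banach[OF A]) auto
  have c_le: "cmod (c i u) \<le> A i * (w u / r ^ (\<Sum>b\<in>E. \<alpha> b))" if "i \<in> I \<alpha>" for i u \<alpha>
    using *(4)[of i u] that r by (simp add: I_def field_simps)
  have cI: "((\<lambda>i. c i u) has_sum d \<alpha> u) (I \<alpha>)" for \<alpha> u
  proof -
    have "(\<lambda>i. A i * (w u / r ^ (\<Sum>b\<in>E. \<alpha> b))) summable_on I \<alpha>"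
      using AI by (intro summable_on_cmult_left) (auto simp: summable_on_def)
    then have "(\<lambda>i. cmod (c i u)) summable_on I \<alpha>"
      by (rule Infinite_Sum.abs_summable_on_comparison_test') (rule c_le)
    then show ?thesis
      unfolding d_def by (rule has_sum_infsum[OF abs_summable_summable])
  qed
  have 1: "continuous_on UNIV (d \<alpha>)" for \<alpha>
  proof (rule continuous_at_imp_continuous_on, rule ballI)
    fix u0
    \<comment> \<open>\<open>w\<close> may be unbounded, so the M-test is applied locally: on this
      open neighbourhood the weight stays below \<open>w u0 + 1\<close>.\<close>
    define S where "S = {u. w u < w u0 + 1}"
    have S: "open S" "u0 \<in> S"
      unfolding S_def using w by (auto intro!: open_Collect_less continuous_intros)
    have "uniform_limit S (\<lambda>F u. \<Sum>i\<in>F. c i u) (d \<alpha>) (finite_subsets_at_top (I \<alpha>))"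
    proof (rule Weierstrass_m_test_general'[OF _ cI])
      show "cmod (c i u) \<le> A i * ((w u0 + 1) / r ^ (\<Sum>b\<in>E. \<alpha> b))" if "i \<in> I \<alpha>" "u \<in> S" for i u
        using that *(3)[of i] r
        by (intro order_trans[OF c_le[OF that(1)]] mult_left_mono divide_right_mono) (auto simp: S_def)
      show "(\<lambda>i. A i * ((w u0 + 1) / r ^ (\<Sum>b\<in>E. \<alpha> b))) summable_on I \<alpha>"
        using AI by (intro summable_on_cmult_left) (auto simp: summable_on_def)
    qed
    then have "continuous_on S (d \<alpha>)"
      by (rule uniform_limit_theorem[rotated])
        (auto intro!: always_eventually continuous_intros continuous_on_subset[OF *(2)])
    then show "isCont (d \<alpha>) u0"
      using S by (simp add: continuous_on_eq_continuous_at)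
  qed
  have 2: "cmod (d \<alpha> u) * r ^ (\<Sum>b\<in>E. \<alpha> b) \<le> a \<alpha> * w u" for \<alpha> u
  proof -
    have "cmod (d \<alpha> u) \<le> a \<alpha> * (w u / r ^ (\<Sum>b\<in>E. \<alpha> b))"
      by (rule norm_infsum_le[OF cI has_sum_cmult_left[OF AI] c_le])
    then show ?thesis using r by (simp add: field_simps)
  qed
  have "((\<lambda>p. A (snd p)) has_sum infsum A UNIV) (Sigma (multi_indices E) I)"
    using has_sum_infsum[OF A] by (subst has_sum_reindex_bij_betw[OF bij, symmetric]) simp
  then have "(a has_sum infsum A UNIV) (multi_indices E)"
    by (rule has_sum_SigmaD) (use AI in auto)
  then have 3: "a summable_on multi_indices E"
    by (auto simp: summable_on_def)
  have 4: "((\<lambda>\<alpha>. of_real (\<Prod>b\<in>E. t b ^ \<alpha> b) * d \<alpha> u) has_sum f t u) (multi_indices E)"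
    if t: "\<forall>b\<in>E. \<bar>t b\<bar> \<le> r" for t u
  proof -
    have "((\<lambda>p. of_real (\<Prod>b\<in>E. t b ^ fst p b) * c (snd p) u) has_sum f t u) (Sigma (multi_indices E) I)"
      using *(6)[OF t, of u] by (subst has_sum_reindex_bij_betw[OF bij, symmetric]) simp
    then show ?thesis
    proof (rule has_sum_SigmaD)
      fix \<alpha>
      show "((\<lambda>i. of_real (\<Prod>b\<in>E. t b ^ fst (\<alpha>, i) b) * c (snd (\<alpha>, i)) u) has_sum of_real (\<Prod>b\<in>E. t b ^ \<alpha> b) * d \<alpha> u) (I \<alpha>)"
        unfolding fst_conv snd_conv by (rule has_sum_cmult_right[OF cI])
    qed
  qed
  show ?thesis by (rule that[OF 1 2 3 4])
qed

section \<open>The exponential of a majorized series\<close>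

lemma power_le_fact_exp:
  fixes s :: real assumes "0 \<le> s" shows "s ^ k \<le> fact k * exp s"
proof -
  have "s ^ k / fact k \<le> (\<Sum>n<Suc k. s ^ n / fact n)"
    using assms by (simp add: sum_nonneg)
  also have "\<dots> \<le> (\<Sum>n. s ^ n / fact n)"
    using assms summable_exp[of s]
    by (intro sum_le_suminf) (auto simp: divide_inverse mult.commute)
  also have "\<dots> = exp s"
    by (simp add: exp_def divide_inverse mult.commute)
  finally show ?thesis by (simp add: field_simps)
qed

text \<open>The estimate \<open>w ^ k \<le> fact k * exp w\<close> uses up the factor
  \<open>1 / fact k\<close> of the exponential series and leaves the powers of
  \<open>\<delta>\<close>. For \<open>\<delta> \<le> 1 / 2\<close> their sum is at most 2.\<close>

lemma majorized_exp:
  assumes f: "majorized E r w \<delta> f" and "\<delta> \<le> 1 / 2" "0 \<le> r"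
  shows "majorized E r (\<lambda>u. exp (w u)) 2 (\<lambda>t u. exp (f t u))"
proof (rule majorized_has_sum)
  fix k
  have "majorized E r (\<lambda>u. w u ^ k) (cmod (1 / fact k) * \<delta> ^ k) (\<lambda>t u. 1 / fact k * f t u ^ k)"
    by (intro majorized_cmult majorized_power f assms)
  then have "majorized E r (\<lambda>u. exp (w u)) (fact k * (cmod (1 / fact k) * \<delta> ^ k)) (\<lambda>t u. 1 / fact k * f t u ^ k)"
    by (rule majorized_weight) (auto intro!: power_le_fact_exp majorized_nonneg(2)[OF f])
  moreover have "fact k * (cmod (1 / fact k) * \<delta> ^ k) \<le> (1 / 2) ^ k"
    using assms majorized_nonneg(1)[OF f] power_mono[of \<delta> "1/2" k] by (simp add: norm_divide)
  ultimately show "majorized E r (\<lambda>u. exp (w u)) ((1 / 2) ^ k) (\<lambda>t u. 1 / fact k * f t u ^ k)"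
    by (rule majorized_mono)
next
  have "(\<lambda>k. (1 / 2 :: real) ^ k) sums 2" using geometric_sums[of "1/2::real"] by simp
  then show "((\<lambda>k. (1 / 2 :: real) ^ k) has_sum 2) UNIV"
    by (intro sums_nonneg_imp_has_sum) auto
next
  fix t u
  have "(\<lambda>k. 1 / fact k * f t u ^ k) sums exp (f t u)"
    using exp_converges[of "f t u"] by (simp add: scaleR_conv_of_real divide_inverse)
  moreover have "summable (\<lambda>k. cmod (1 / fact k * f t u ^ k))"
    using summable_norm_exp[of "f t u"] by (simp add: norm_mult norm_power norm_inverse divide_inverse)
  ultimately show "((\<lambda>k. 1 / fact k * f t u ^ k) has_sum exp (f t u)) UNIV"
    by (intro norm_summable_imp_has_sum)
qed

section \<open>The matrix exponential\<close>

definition matrix_power :: "real^'n^'n \<Rightarrow> nat \<Rightarrow> real^'n^'n" where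
  "matrix_power A k = ((**) A ^^ k) (mat 1)"

lemma matrix_power_0 [simp]: "matrix_power A 0 = mat 1"
  and matrix_power_Suc: "matrix_power A (Suc k) = A ** matrix_power A k"
  by (simp_all add: matrix_power_def)

lemma matrix_power_add: "matrix_power A (k + l) = matrix_power A k ** matrix_power A l"
  by (induction k) (simp_all add: matrix_power_Suc matrix_mul_assoc)

lemma matrix_power_minus: "matrix_power (- A) k = (-1) ^ k *\<^sub>R matrix_power A k"
proof (induction k)
  case (Suc k)
  have "(- A) ** (c *\<^sub>R B) = (- c) *\<^sub>R (A ** B)" for c and A B :: "real^'n^'n"
    by (simp add: vec_eq_iff matrix_matrix_mult_def sum_distrib_left sum_negf mult_ac)
  with Suc show ?case by (simp add: matrix_power_Suc)
qed simp

text \<open>Every multiplication by \<open>A\<close> sums \<open>CARD('n)\<close> products of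
  entries, hence one such factor per step.\<close>

lemma matrix_power_nth_le:
  fixes A :: "real^'n^'n"
  assumes "\<And>i j. \<bar>A $ i $ j\<bar> \<le> a"
  shows "\<bar>matrix_power A k $ i $ j\<bar> \<le> (real CARD('n) * a) ^ k"
proof (induction k arbitrary: i j)
  case 0
  show ?case by (simp add: mat_def)
next
  case (Suc k)
  have "\<bar>matrix_power A (Suc k) $ i $ j\<bar> \<le> (\<Sum>l\<in>(UNIV::'n set). a * (real CARD('n) * a) ^ k)"
    unfolding matrix_power_Suc matrix_matrix_mult_def vec_lambda_beta
    by (rule order_trans[OF sum_abs], rule sum_mono, unfold abs_mult, rule mult_mono[OF assms Suc])
      (use order_trans[OF abs_ge_zero assms] in auto)
  then show ?case by (simp add: mult_ac)
qed

text \<open>Entry by entry the exponential is an absolutely convergent scalar series, the form in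
  which Cauchy products and majorants apply.\<close>

lemma matrix_exp_entry:
  fixes A :: "real^'n^'n" and i j :: 'n
  shows "summable (\<lambda>k. \<bar>matrix_power A k $ i $ j / fact k\<bar>)"
    and "(\<lambda>k. matrix_power A k $ i $ j / fact k) sums (matrix_exp A $ i $ j)"
proof -
  have le: "\<bar>A $ i $ j\<bar> \<le> norm A" for i j :: 'n
    using Finite_Cartesian_Product.norm_nth_le[of A i] Finite_Cartesian_Product.norm_nth_le[of "A $ i" j] by simp
  have s: "summable (\<lambda>k. \<bar>matrix_power A k $ i $ j / fact k\<bar>)" for i j :: 'n
  proof (rule summable_comparison_test')
    show "summable (\<lambda>k. (real CARD('n) * norm A) ^ k / fact k)"
      using summable_exp[of "real CARD('n) * norm A"] by (simp add: divide_inverse mult.commute)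
    show "norm \<bar>matrix_power A k $ i $ j / fact k\<bar> \<le> (real CARD('n) * norm A) ^ k / fact k" for k
      using matrix_power_nth_le[OF le, of k i j] by (simp add: divide_right_mono)
  qed
  then show "summable (\<lambda>k. \<bar>matrix_power A k $ i $ j / fact k\<bar>)" .
  have s': "summable (\<lambda>k. matrix_power A k $ i $ j / fact k)" for i j :: 'n
    by (rule summable_rabs_cancel[OF s])
  have "(\<lambda>k. (1 / fact k) *\<^sub>R matrix_power A k) sums (\<chi> i j. \<Sum>k. matrix_power A k $ i $ j / fact k)"
    unfolding sums_def
    by (intro vec_tendstoI) (use summable_LIMSEQ[OF s'] in simp)
  then have "matrix_exp A = (\<chi> i j. \<Sum>k. matrix_power A k $ i $ j / fact k)"
    unfolding matrix_exp_def matrix_power_def by (rule sums_unique[symmetric])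
  then show "(\<lambda>k. matrix_power A k $ i $ j / fact k) sums (matrix_exp A $ i $ j)"
    using s' by (simp add: summable_sums)
qed

text \<open>The Cauchy product is formed for entries. Its term of degree \<open>k\<close> is an
  entry of \<open>matrix_power A k\<close> times the binomial expansion of
  \<open>(1 + -1) ^ k\<close>, over \<open>fact k\<close>, and so vanishes unless
  \<open>k = 0\<close>.\<close>

lemma matrix_exp_minus:
  fixes A :: "real^'n^'n"
  shows "matrix_exp A ** matrix_exp (- A) = mat 1"
proof -
  have "(matrix_exp A ** matrix_exp (- A)) $ i $ j = (mat 1 :: real^'n^'n) $ i $ j" for i j :: 'n
  proof -
    let ?p = "\<lambda>A i j k. matrix_power A k $ i $ j / fact k"
    have "(\<lambda>k. \<Sum>l\<in>UNIV. \<Sum>m\<le>k. ?p A i l m * ?p (- A) l j (k - m)) sums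
      (\<Sum>l\<in>UNIV. matrix_exp A $ i $ l * matrix_exp (- A) $ l $ j)"
    proof (rule sums_sum)
      fix l
      show "(\<lambda>k. \<Sum>m\<le>k. ?p A i l m * ?p (- A) l j (k - m)) sums (matrix_exp A $ i $ l * matrix_exp (- A) $ l $ j)"
        using Cauchy_product_sums[of "?p A i l" "?p (- A) l j", unfolded real_norm_def,
            OF matrix_exp_entry(1) matrix_exp_entry(1)]
        by (simp only: matrix_exp_entry(2)[THEN sums_unique, symmetric])
    qed
    moreover have "(\<Sum>l\<in>UNIV. \<Sum>m\<le>k. ?p A i l m * ?p (- A) l j (k - m)) = (if k = 0 then (mat 1 :: real^'n^'n) $ i $ j else 0)" for k
    proof -
      have "(\<Sum>l\<in>UNIV. \<Sum>m\<le>k. ?p A i l m * ?p (- A) l j (k - m)) =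
        (\<Sum>m\<le>k. \<Sum>l\<in>UNIV. ?p A i l m * ?p (- A) l j (k - m))"
        by (rule sum.swap)
      also have "\<dots> = (\<Sum>m\<le>k. matrix_power A k $ i $ j * ((-1) ^ (k - m) / (fact m * fact (k - m))))"
      proof (rule sum.cong[OF refl])
        fix m assume "m \<in> {..k}"
        then have "matrix_power A k = matrix_power A m ** matrix_power A (k - m)"
          by (simp flip: matrix_power_add)
        then have "matrix_power A k $ i $ j = (\<Sum>l\<in>UNIV. matrix_power A m $ i $ l * matrix_power A (k - m) $ l $ j)"
          by (simp add: matrix_matrix_mult_def)
        then show "(\<Sum>l\<in>UNIV. ?p A i l m * ?p (- A) l j (k - m)) = matrix_power A k $ i $ j * ((-1) ^ (k - m) / (fact m * fact (k - m)))"
          by (simp add: matrix_power_minus sum_distrib_left sum_distrib_right sum_divide_distrib mult_ac)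
      qed
      also have "\<dots> = matrix_power A k $ i $ j * (\<Sum>m\<le>k. of_nat (k choose m) * 1 ^ m * (-1) ^ (k - m)) / fact k"
        by (simp add: sum_distrib_left sum_divide_distrib binomial_fact mult_ac)
      also have "\<dots> = matrix_power A k $ i $ j * (1 + -1) ^ k / fact k"
        by (subst binomial_ring) simp
      finally show ?thesis by (simp add: power_0_left)
    qed
    ultimately have "(\<lambda>k. if k = 0 then (mat 1 :: real^'n^'n) $ i $ j else 0) sums
      (\<Sum>l\<in>UNIV. matrix_exp A $ i $ l * matrix_exp (- A) $ l $ j)"
      by simp
    moreover have "(\<lambda>k. if k = 0 then (mat 1 :: real^'n^'n) $ i $ j else 0) sums (mat 1 :: real^'n^'n) $ i $ j"
      using sums_single[of 0 "\<lambda>_. (mat 1 :: real^'n^'n) $ i $ j"] by simp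
    ultimately show ?thesis
      by (simp add: matrix_matrix_mult_def sums_unique2)
  qed
  then show ?thesis by (simp add: vec_eq_iff)
qed

lemma matrix_inv_inverse:
  assumes "invertible A"
  shows "A ** matrix_inv A = mat 1" "matrix_inv A ** A = mat 1"
  using someI_ex[OF assms[unfolded invertible_def]] by (simp_all add: matrix_inv_def)

lemma matrix_inv_eqI:
  fixes A :: "real^'n^'n"
  assumes "A ** B = mat 1" "B ** A = mat 1"
  shows "matrix_inv A = B"
proof -
  have "invertible A" using assms by (auto simp: invertible_def)
  then have "matrix_inv A = matrix_inv A ** (A ** B)" "matrix_inv A ** A = mat 1"
    by (simp_all add: assms matrix_inv_inverse)
  then show ?thesis by (simp add: matrix_mul_assoc)
qed

text \<open>In the orbit map this puts the inverse of \<open>g\<close> next to \<open>m\<close>, so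
  that only \<open>matrix_exp (- X)\<close> depends on the coordinates.\<close>

lemma matrix_inv_mult_exp:
  fixes g X :: "real^'n^'n"
  assumes "invertible g"
  shows "matrix_inv (g ** matrix_exp X) = matrix_exp (- X) ** matrix_inv g"
proof (rule matrix_inv_eqI)
  have 1: "matrix_exp (- X) ** matrix_exp X = mat 1" using matrix_exp_minus[of "- X"] by simp
  have 2: "g ** matrix_inv g = mat 1" "matrix_inv g ** g = mat 1"
    by (rule matrix_inv_inverse[OF assms])+
  have "(g ** matrix_exp X) ** (matrix_exp (- X) ** matrix_inv g) = g ** (matrix_exp X ** matrix_exp (- X)) ** matrix_inv g"
    by (simp add: matrix_mul_assoc)
  then show "(g ** matrix_exp X) ** (matrix_exp (- X) ** matrix_inv g) = mat 1"
    by (simp add: matrix_exp_minus 2)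
  have "(matrix_exp (- X) ** matrix_inv g) ** (g ** matrix_exp X) = matrix_exp (- X) ** (matrix_inv g ** g) ** matrix_exp X"
    by (simp add: matrix_mul_assoc)
  then show "(matrix_exp (- X) ** matrix_inv g) ** (g ** matrix_exp X) = mat 1"
    by (simp add: 1 2)
qed

section \<open>Majorants for the matrix exponential\<close>

lemma matrix_power_majorized:
  fixes E :: "(real^'n^'n) set"
  assumes E: "finite E" and r: "0 \<le> r"
  shows "majorized E r (\<lambda>_ :: 'v::topological_space. 1) ((real CARD('n) * (r * (\<Sum>b\<in>E. norm b))) ^ k)
           (\<lambda>t u. of_real (matrix_power (- (\<Sum>b\<in>E. t b *\<^sub>R b)) k $ i $ j))"
proof (induction k arbitrary: i j)
  case 0
  have "majorized E r (\<lambda>_ :: 'v::topological_space. 1) 1 (\<lambda>t u. complex_of_real ((mat 1 :: real^'n^'n) $ i $ j))"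
    by (rule majorized_const) (auto simp: mat_def r)
  then show ?case by simp
next
  case (Suc k)
  \<comment> \<open>If all \<open>\<bar>t b\<bar> \<le> r\<close>, the entries of the exponent are
    at most \<open>?a\<close>. The induction repeats the entry bound for matrix powers at the level
    of series in \<open>t\<close>.\<close>
  let ?a = "r * (\<Sum>b\<in>E. norm b)"
  have X: "majorized E r (\<lambda>_ :: 'v::topological_space. 1) ?a (\<lambda>t u. of_real ((- (\<Sum>b\<in>E. t b *\<^sub>R b)) $ i $ l))" for l
  proof (rule majorized_mono[OF majorized_cong])
    show "majorized E r (\<lambda>_ :: 'v::topological_space. 1) (\<Sum>b\<in>E. \<bar>- (b $ i $ l)\<bar> * r) (\<lambda>t u. \<Sum>b\<in>E. of_real (t b * - (b $ i $ l)))"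
      by (intro majorized_sum majorized_coordinate E r) auto
    show "(\<Sum>b\<in>E. of_real (t b * - (b $ i $ l))) = of_real ((- (\<Sum>b\<in>E. t b *\<^sub>R b)) $ i $ l)" for t :: "_ \<Rightarrow> real"
      by (simp add: sum_component sum_negf)
    have "\<bar>b $ i $ l\<bar> \<le> norm b" for b :: "real^'n^'n"
      using Finite_Cartesian_Product.norm_nth_le[of b i] component_le_norm_cart[of "b $ i" l] by simp
    then show "(\<Sum>b\<in>E. \<bar>- (b $ i $ l)\<bar> * r) \<le> ?a"
      using r by (simp add: sum_distrib_left mult.commute[of r] sum_mono mult_right_mono)
  qed
  have "majorized E r (\<lambda>_ :: 'v::topological_space. 1) (\<Sum>l\<in>(UNIV::'n set). ?a * (real CARD('n) * ?a) ^ k)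
     (\<lambda>t u. \<Sum>l\<in>UNIV. of_real ((- (\<Sum>b\<in>E. t b *\<^sub>R b)) $ i $ l) *
        of_real (matrix_power (- (\<Sum>b\<in>E. t b *\<^sub>R b)) k $ l $ j))"
  proof (rule majorized_sum)
    show "majorized E r (\<lambda>_ :: 'v::topological_space. 1) (?a * (real CARD('n) * ?a) ^ k)
     (\<lambda>t u. of_real ((- (\<Sum>b\<in>E. t b *\<^sub>R b)) $ i $ l) *
        of_real (matrix_power (- (\<Sum>b\<in>E. t b *\<^sub>R b)) k $ l $ j))" for l
      using majorized_mult[OF X[of l] Suc[of l j] r] by simp
  qed (use r in auto)
  then show ?case
    unfolding matrix_power_Suc matrix_matrix_mult_def vec_lambda_beta by (simp add: mult_ac)
qed

text \<open>Without its term of degree 0 the series has a total that tends to 0 with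
  \<open>r\<close>. All smallness needed later comes from here.\<close>

lemma matrix_exp_majorized:
  fixes E :: "(real^'n^'n) set"
  assumes E: "finite E" and r: "0 \<le> r"
  shows "majorized E r (\<lambda>_. 1) (exp (real CARD('n) * (r * (\<Sum>b\<in>E. norm b))) - 1)
           (\<lambda>t u. of_real ((matrix_exp (- (\<Sum>b\<in>E. t b *\<^sub>R b)) - mat 1) $ i $ j))"
proof (rule majorized_has_sum)
  let ?a = "real CARD('n) * (r * (\<Sum>b\<in>E. norm b))"
  let ?X = "\<lambda>t. - (\<Sum>b\<in>E. t b *\<^sub>R b)"
  show "majorized E r (\<lambda>_. 1) (cmod (of_real (1 / fact (Suc k))) * ?a ^ Suc k)
     (\<lambda>t u. of_real (1 / fact (Suc k)) * of_real (matrix_power (?X t) (Suc k) $ i $ j))" for k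
    by (rule majorized_cmult[OF matrix_power_majorized[OF E r] r])
  have "(\<lambda>k. ?a ^ k / fact k) sums exp ?a"
    using exp_converges[of ?a] by (simp add: divide_inverse mult.commute)
  then have "(\<lambda>k. ?a ^ Suc k / fact (Suc k)) sums (exp ?a - 1)"
    by (subst sums_Suc_iff) simp
  then have "((\<lambda>k. ?a ^ Suc k / fact (Suc k)) has_sum (exp ?a - 1)) UNIV"
    using r by (intro sums_nonneg_imp_has_sum) (auto intro!: divide_nonneg_nonneg zero_le_power mult_nonneg_nonneg sum_nonneg simp del: fact_Suc power_Suc)
  then show "((\<lambda>k. cmod (of_real (1 / fact (Suc k))) * ?a ^ Suc k) has_sum (exp ?a - 1)) UNIV"
    unfolding norm_of_real by (simp del: fact_Suc power_Suc)
  fix t :: "real^'n^'n \<Rightarrow> real"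
  have "(\<lambda>k. matrix_power (?X t) (Suc k) $ i $ j / fact (Suc k)) sums (matrix_exp (?X t) - mat 1) $ i $ j"
    using matrix_exp_entry(2)[of "?X t" i j] by (subst sums_Suc_iff) simp
  moreover have "summable (\<lambda>k. norm (matrix_power (?X t) (Suc k) $ i $ j / fact (Suc k)))"
    using matrix_exp_entry(1)[of "?X t" i j] by (subst summable_Suc_iff) simp
  ultimately have "((\<lambda>k. matrix_power (?X t) (Suc k) $ i $ j / fact (Suc k)) has_sum (matrix_exp (?X t) - mat 1) $ i $ j) UNIV"
    by (intro norm_summable_imp_has_sum)
  from has_sum_of_real[OF this, where 'a = complex]
  show "((\<lambda>k. complex_of_real (1 / fact (Suc k)) * of_real (matrix_power (?X t) (Suc k) $ i $ j)) has_sum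
      of_real ((matrix_exp (?X t) - mat 1) $ i $ j)) (UNIV :: nat set)"
    unfolding of_real_mult[symmetric] times_divide_eq_left mult_1_left .
qed

text \<open>The displacement of \<open>u\<close> is linear in \<open>u\<close>, hence the weight
  \<open>norm\<close>; the total still tends to 0 with \<open>r\<close>.\<close>

lemma matrix_exp_minus_id_majorized:
  fixes E :: "(real^'n^'n) set"
  assumes E: "finite E" and r: "0 \<le> r"
  defines "\<eta> \<equiv> exp (real CARD('n) * (r * (\<Sum>b\<in>E. norm b))) - 1"
  shows "majorized E r norm (real CARD('n) * \<eta>)
     (\<lambda>t u. of_real ((matrix_exp (- (\<Sum>b\<in>E. t b *\<^sub>R b)) *v u) $ i - u $ i))"
proof -
  have "majorized E r norm (\<Sum>j\<in>(UNIV::'n set). \<eta> * 1)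
     (\<lambda>t u. \<Sum>j\<in>UNIV. of_real ((matrix_exp (- (\<Sum>b\<in>E. t b *\<^sub>R b)) - mat 1) $ i $ j) * of_real (u $ j))"
  proof (rule majorized_sum)
    fix j
    have "majorized E r (\<lambda>u. 1 * norm u) (\<eta> * 1)
     (\<lambda>t u. of_real ((matrix_exp (- (\<Sum>b\<in>E. t b *\<^sub>R b)) - mat 1) $ i $ j) * of_real (u $ j))"
      unfolding \<eta>_def
      by (intro majorized_mult matrix_exp_majorized majorized_const E r)
        (auto intro!: continuous_intros simp: component_le_norm_cart)
    then show "majorized E r norm (\<eta> * 1)
     (\<lambda>t u. of_real ((matrix_exp (- (\<Sum>b\<in>E. t b *\<^sub>R b)) - mat 1) $ i $ j) * of_real (u $ j))"
      by simp
  qed (use r in auto)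
  moreover have "(\<Sum>j\<in>UNIV. (Y - mat 1) $ i $ j * u $ j) = (Y *v u) $ i - u $ i" for Y :: "real^'n^'n" and u
  proof -
    have "((Y - mat 1) *v u) $ i = (Y *v u) $ i - u $ i"
      by (simp add: matrix_vector_mult_diff_rdistrib)
    then show ?thesis by (simp add: matrix_vector_mult_def)
  qed
  ultimately show ?thesis
    by (simp del: of_real_diff vector_minus_component flip: of_real_mult of_real_sum)
qed

section \<open>Orbits of Gaussian polynomials\<close>

text \<open>Any \<open>r \<ge> 0\<close> is admissible, so the choice of radius can be left to the
  Gaussian factor. Since \<open>1 + norm u\<close> is at least 1, the weights increase with
  \<open>d\<close> and a crude degree bound suffices: exponents are added even for sums.\<close>

lemma polynomial_orbit_majorized:
  fixes E :: "(real^'n^'n) set"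
  assumes E: "finite E" and r: "0 \<le> r" and p: "real_polynomial_function p"
  shows "\<exists>d C. majorized E r (\<lambda>u. (1 + norm u) ^ d) C
     (\<lambda>t u. of_real (p (matrix_exp (- (\<Sum>b\<in>E. t b *\<^sub>R b)) *v u)))"
  using p
proof induction
  case (linear f)
  let ?Y = "\<lambda>t. matrix_exp (- (\<Sum>b\<in>E. t b *\<^sub>R b))"
  define \<eta> where "\<eta> = exp (real CARD('n) * (r * (\<Sum>b\<in>E. norm b))) - 1"
  \<comment> \<open>A linear form is evaluated through coordinates, each split into displacement
    plus \<open>u $ i\<close> so that the majorant of the displacement applies.\<close>
  have "majorized E r norm (\<Sum>i\<in>UNIV. cmod (of_real (f (axis i 1))) * (real CARD('n) * \<eta> + 1))
     (\<lambda>t u. \<Sum>i\<in>UNIV. of_real (f (axis i 1)) * (of_real ((?Y t *v u) $ i - u $ i) + of_real (u $ i)))"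
    unfolding \<eta>_def
    by (intro majorized_sum majorized_cmult majorized_add matrix_exp_minus_id_majorized majorized_const E r)
      (auto intro!: continuous_intros simp: component_le_norm_cart)
  moreover have "(\<Sum>i\<in>UNIV. f (axis i 1) * ((v $ i - u $ i) + u $ i)) = f v" for u v
  proof -
    interpret bounded_linear f by (rule linear)
    have "f v = f (\<Sum>i\<in>UNIV. (v $ i) *\<^sub>R axis i 1)"
      using basis_expansion[of v] by (simp add: scalar_mult_eq_scaleR)
    then show ?thesis by (simp add: sum scaleR mult.commute)
  qed
  ultimately have "majorized E r norm (\<Sum>i\<in>UNIV. cmod (of_real (f (axis i 1))) * (real CARD('n) * \<eta> + 1))
     (\<lambda>t u. of_real (f (?Y t *v u)))"
    by (simp flip: of_real_mult of_real_sum of_real_add of_real_diff)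
  then have "majorized E r (\<lambda>u. (1 + norm u) ^ 1) (1 * (\<Sum>i\<in>UNIV. cmod (of_real (f (axis i 1))) * (real CARD('n) * \<eta> + 1)))
     (\<lambda>t u. of_real (f (?Y t *v u)))"
    by (rule majorized_weight) auto
  then show ?case by blast
next
  case (const c)
  have "majorized E r (\<lambda>u. (1 + norm u) ^ 0) \<bar>c\<bar> (\<lambda>t u :: real^'n. of_real c)"
    by (rule majorized_const) (auto simp: r)
  then show ?case by blast
next
  case (add f g)
  then obtain d C d' C' where
    f: "majorized E r (\<lambda>u. (1 + norm u) ^ d) C (\<lambda>t u. of_real (f (matrix_exp (- (\<Sum>b\<in>E. t b *\<^sub>R b)) *v u)))" and
    g: "majorized E r (\<lambda>u. (1 + norm u) ^ d') C' (\<lambda>t u. of_real (g (matrix_exp (- (\<Sum>b\<in>E. t b *\<^sub>R b)) *v u)))"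
    by blast
  have "majorized E r (\<lambda>u. (1 + norm u) ^ (d + d')) (1 * C + 1 * C')
    (\<lambda>t u. of_real (f (matrix_exp (- (\<Sum>b\<in>E. t b *\<^sub>R b)) *v u)) + of_real (g (matrix_exp (- (\<Sum>b\<in>E. t b *\<^sub>R b)) *v u)))"
    by (intro majorized_add majorized_weight[OF f] majorized_weight[OF g] r)
      (auto intro!: power_increasing)
  then show ?case by auto
next
  case (mult f g)
  then obtain d C d' C' where
    f: "majorized E r (\<lambda>u. (1 + norm u) ^ d) C (\<lambda>t u. of_real (f (matrix_exp (- (\<Sum>b\<in>E. t b *\<^sub>R b)) *v u)))" and
    g: "majorized E r (\<lambda>u. (1 + norm u) ^ d') C' (\<lambda>t u. of_real (g (matrix_exp (- (\<Sum>b\<in>E. t b *\<^sub>R b)) *v u)))"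
    by blast
  have "majorized E r (\<lambda>u. (1 + norm u) ^ (d + d')) (C * C')
    (\<lambda>t u. of_real (f (matrix_exp (- (\<Sum>b\<in>E. t b *\<^sub>R b)) *v u)) * of_real (g (matrix_exp (- (\<Sum>b\<in>E. t b *\<^sub>R b)) *v u)))"
    using majorized_mult[OF f g r] by (simp add: power_add)
  then show ?case by auto
qed

lemma complex_polynomial_orbit_majorized:
  fixes E :: "(real^'n^'n) set" and p :: "real^'n \<Rightarrow> complex"
  assumes E: "finite E" and r: "0 \<le> r" and p: "polynomial_function p"
  shows "\<exists>d C. majorized E r (\<lambda>u. (1 + norm u) ^ d) C
     (\<lambda>t u. p (matrix_exp (- (\<Sum>b\<in>E. t b *\<^sub>R b)) *v u))"
proof -
  have "real_polynomial_function (\<lambda>x. Re (p x))" "real_polynomial_function (\<lambda>x. Im (p x))"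
    using p bounded_linear_Re bounded_linear_Im unfolding polynomial_function_def o_def by auto
  from this[THEN polynomial_orbit_majorized[OF E r]] obtain d C d' C' where
    f: "majorized E r (\<lambda>u. (1 + norm u) ^ d) C (\<lambda>t u. of_real (Re (p (matrix_exp (- (\<Sum>b\<in>E. t b *\<^sub>R b)) *v u))))" and
    g: "majorized E r (\<lambda>u. (1 + norm u) ^ d') C' (\<lambda>t u. of_real (Im (p (matrix_exp (- (\<Sum>b\<in>E. t b *\<^sub>R b)) *v u))))"
    by (elim exE) (rule that)
  have "majorized E r (\<lambda>u. (1 + norm u) ^ (d + d')) (1 * C + 1 * (cmod \<i> * C'))
    (\<lambda>t u. of_real (Re (p (matrix_exp (- (\<Sum>b\<in>E. t b *\<^sub>R b)) *v u))) + \<i> * of_real (Im (p (matrix_exp (- (\<Sum>b\<in>E. t b *\<^sub>R b)) *v u))))"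
    by (intro majorized_add majorized_weight[OF f] majorized_weight[OF majorized_cmult[OF g]] r)
      (auto intro!: power_increasing)
  then show ?thesis by (auto simp flip: complex_eq)
qed

text \<open>With the displacement \<open>z = Y u - u\<close>, the function \<open>q\<close> is the
  sum of \<open>2 * u $ i * z $ i + z $ i * z $ i\<close>. Each summand has weight
  \<open>norm u * norm u\<close> and a total that tends to 0 with \<open>r\<close>. The quarter is a
  choice: any fraction of \<open>norm u ^ 2\<close> below 1 would leave decay.\<close>

lemma gaussian_orbit_majorized:
  fixes E :: "(real^'n^'n) set"
  assumes E: "finite E"
  shows "\<exists>r>0. majorized E r (\<lambda>u. exp (norm u ^ 2 / 4 - norm u ^ 2)) 2
     (\<lambda>t u. of_real (exp (- (\<Sum>i\<in>UNIV. ((matrix_exp (- (\<Sum>b\<in>E. t b *\<^sub>R b)) *v u) $ i)\<^sup>2))))"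
proof -
  \<comment> \<open>\<open>\<zeta> r\<close> is the total for one coordinate of the displacement.
    \<open>\<delta> r\<close> is the total for \<open>q\<close> against the weight
    \<open>norm u ^ 2 / 4\<close>: the factor 4 undoes the quarter, and \<open>CARD('n)\<close>
    counts the coordinates.\<close>
  define \<zeta> where "\<zeta> r = real CARD('n) * (exp (real CARD('n) * (r * (\<Sum>b\<in>E. norm b))) - 1)" for r
  define \<delta> where "\<delta> r = 4 * (real CARD('n) * (2 * \<zeta> r + \<zeta> r * \<zeta> r))" for r
  have "continuous (at 0) \<delta>"
    unfolding \<delta>_def \<zeta>_def by (intro continuous_intros)
  moreover have "\<delta> 0 = 0" by (simp add: \<delta>_def \<zeta>_def)
  ultimately have "\<forall>\<^sub>F r in at_right 0. \<delta> r < 1 / 2"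
    by (intro order_tendstoD(2)[of _ "\<delta> 0"]) (auto simp: continuous_at intro: tendsto_within_subset)
  then have "\<forall>\<^sub>F r in at_right 0. \<delta> r < 1 / 2 \<and> 0 < r"
    using eventually_at_right_less by (rule eventually_conj)
  then obtain r where r: "\<delta> r < 1 / 2" "0 < r"
    using eventually_happens[of _ "at_right (0::real)"] by (auto simp: trivial_limit_at_right_real)
  let ?z = "\<lambda>i t u. (matrix_exp (- (\<Sum>b\<in>E. t b *\<^sub>R b)) *v u) $ i - u $ i"
  have z: "majorized E r norm (\<zeta> r) (\<lambda>t u. of_real (?z i t u))" for i
    unfolding \<zeta>_def by (rule matrix_exp_minus_id_majorized) (use E r in auto)
  have c: "majorized E r norm 2 (\<lambda>t u :: real^'n. of_real (2 * u $ i))" for i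
    by (rule majorized_const) (use r in \<open>auto intro!: continuous_intros simp: component_le_norm_cart\<close>)
  have "majorized E r (\<lambda>u. norm u * norm u) (\<Sum>i\<in>(UNIV::'n set). 2 * \<zeta> r + \<zeta> r * \<zeta> r)
    (\<lambda>t u. \<Sum>i\<in>UNIV. of_real (2 * u $ i) * of_real (?z i t u) + of_real (?z i t u) * of_real (?z i t u))"
    by (intro majorized_sum majorized_add majorized_mult c z) (use r in auto)
  then have "majorized E r (\<lambda>u. norm u * norm u / 4) (4 * (\<Sum>i\<in>(UNIV::'n set). 2 * \<zeta> r + \<zeta> r * \<zeta> r))
    (\<lambda>t u. \<Sum>i\<in>UNIV. of_real (2 * u $ i) * of_real (?z i t u) + of_real (?z i t u) * of_real (?z i t u))"
    by (rule majorized_weight) auto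
  from majorized_cmult[OF this, of "-1"]
  have "majorized E r (\<lambda>u. norm u ^ 2 / 4) (\<delta> r)
    (\<lambda>t u. - (\<Sum>i\<in>UNIV. of_real (2 * u $ i) * of_real (?z i t u) + of_real (?z i t u) * of_real (?z i t u)))"
    using r by (simp add: \<delta>_def power2_eq_square)
  then have "majorized E r (\<lambda>u. exp (norm u ^ 2 / 4)) 2
    (\<lambda>t u. exp (- (\<Sum>i\<in>UNIV. of_real (2 * u $ i) * of_real (?z i t u) + of_real (?z i t u) * of_real (?z i t u))))"
    by (rule majorized_exp) (use r in auto)
  moreover have "majorized E r (\<lambda>u. exp (- (norm u ^ 2))) 1 (\<lambda>t u :: real^'n. of_real (exp (- (norm u ^ 2))))"
    by (rule majorized_const) (use r in \<open>auto intro!: continuous_intros\<close>)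
  ultimately have *: "majorized E r (\<lambda>u. exp (norm u ^ 2 / 4) * exp (- (norm u ^ 2))) (2 * 1)
    (\<lambda>t u. exp (- (\<Sum>i\<in>UNIV. of_real (2 * u $ i) * of_real (?z i t u) + of_real (?z i t u) * of_real (?z i t u)))
       * of_real (exp (- (norm u ^ 2))))"
    by (rule majorized_mult) (use r in auto)
  have "exp (- (\<Sum>i\<in>UNIV. of_real (2 * u $ i) * of_real (v $ i - u $ i) + of_real (v $ i - u $ i) * of_real (v $ i - u $ i)))
       * of_real (exp (- (norm u ^ 2))) = (of_real (exp (- (\<Sum>i\<in>UNIV. (v $ i)\<^sup>2))) :: complex)" for u v :: "real^'n"
  proof -
    have "norm u ^ 2 = (\<Sum>i\<in>UNIV. (u $ i)\<^sup>2)"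
      by (simp add: norm_vec_def L2_set_def sum_nonneg)
    then have "- (\<Sum>i\<in>UNIV. 2 * u $ i * (v $ i - u $ i) + (v $ i - u $ i) * (v $ i - u $ i)) + - (norm u ^ 2)
      = - (\<Sum>i\<in>UNIV. (v $ i)\<^sup>2)"
      by (simp add: power2_eq_square algebra_simps sum.distrib sum_subtractf)
    then have "exp (- (\<Sum>i\<in>UNIV. 2 * u $ i * (v $ i - u $ i) + (v $ i - u $ i) * (v $ i - u $ i))) * exp (- (norm u ^ 2))
      = exp (- (\<Sum>i\<in>UNIV. (v $ i)\<^sup>2))"
      by (simp flip: exp_add)
    from arg_cong[OF this, of complex_of_real] show ?thesis
      by (simp only: of_real_mult of_real_sum of_real_add of_real_diff of_real_minus exp_of_real[symmetric])
  qed
  note gauss = this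
  have exp: "exp a * exp (- b) = exp (a - b)" for a b :: real
    by (simp flip: exp_add)
  show ?thesis
    using *[unfolded gauss exp mult_1_right] r(2) by blast
qed

section \<open>Decay at infinity and membership in \<open>C0\<close>\<close>

lemma algebraic_set_closed:
  assumes "algebraic_set (Z :: 'a::real_normed_vector set)"
  shows "closed Z"
proof -
  obtain S where S: "\<And>p. p \<in> S \<Longrightarrow> real_polynomial_function p" "Z = {x. \<forall>p\<in>S. p x = 0}"
    using assms unfolding algebraic_set_def by blast
  have "Z = (\<Inter>p\<in>S. {x. p x = 0})" using S by auto
  moreover have "closed {x. p x = 0}" if "p \<in> S" for p
    using continuous_on_polymonial_function[of p UNIV] S(1)[OF that]
    by (intro closed_Collect_eq) (auto simp: real_polynomial_function_eq)
  ultimately show ?thesis by auto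
qed

text \<open>Since \<open>k\<close> is bounded, \<open>m = k *v (h *v m)\<close> forces
  \<open>h *v m\<close> to be large when \<open>m\<close> is, so the decay of \<open>c\<close>
  passes to its transform. Closedness of \<open>M\<close> makes its bounded parts compact.\<close>

lemma C0_transformI:
  fixes M :: "(real^'n) set" and c :: "real^'n \<Rightarrow> complex"
  assumes M: "closed M" and c: "continuous_on UNIV c" "\<And>u. cmod (c u) \<le> a * W u"
    and W: "(W \<longlongrightarrow> 0) at_infinity" and kh: "k ** h = mat 1"
  shows "(\<lambda>m. if m \<in> M then c (h *v m) else 0) \<in> C0 M"
proof -
  have "continuous_on M (\<lambda>m. c (h *v m))"
    by (rule continuous_on_compose2[OF c(1)])
      (auto intro!: linear_continuous_on matrix_vector_mul_bounded_linear)
  moreover have "\<exists>K. compact K \<and> K \<subseteq> M \<and> (\<forall>m\<in>M - K. cmod (c (h *v m)) < e)" if "e > 0" for e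
  proof -
    have "((\<lambda>u. a * W u) \<longlongrightarrow> a * 0) at_infinity" by (intro tendsto_intros W)
    then have "\<forall>\<^sub>F u in at_infinity. a * W u < e"
      using that by (intro order_tendstoD(2)[of _ "a * 0"]) auto
    then obtain R where R: "\<And>u. R \<le> norm u \<Longrightarrow> a * W u < e"
      by (auto simp: eventually_at_infinity)
    obtain B where B: "0 < B" "\<And>u. norm (k *v u) \<le> norm u * B"
      using bounded_linear.pos_bounded[OF matrix_vector_mul_bounded_linear[of k]] by blast
    have "cmod (c (h *v m)) < e" if "m \<in> M - (M \<inter> cball 0 (R * B))" for m
    proof -
      have "R * B < norm m" using that by auto
      also have "m = k *v (h *v m)" using kh by (simp add: matrix_vector_mul_assoc)
      also have "norm \<dots> \<le> norm (h *v m) * B" by (rule B)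
      finally have "R < norm (h *v m)" using B by simp
      then show ?thesis using R[of "h *v m"] c(2)[of "h *v m"] by simp
    qed
    moreover have "compact (M \<inter> cball 0 (R * B))" using M by (intro closed_Int_compact) auto
    ultimately show ?thesis by blast
  qed
  ultimately show ?thesis
    unfolding C0_def by (auto cong: continuous_on_cong)
qed

lemma sup_norm_le:
  assumes "0 \<le> K" "\<And>m. m \<in> M \<Longrightarrow> cmod (f m) \<le> K"
  shows "\<bar>sup_norm M f\<bar> \<le> K"
proof -
  let ?S = "insert 0 ((\<lambda>m. cmod (f m)) ` M)"
  have "Sup ?S \<le> K" using assms by (intro cSup_least) auto
  moreover have "0 \<le> Sup ?S" using assms by (intro cSup_upper bdd_aboveI[of _ K]) auto
  ultimately show ?thesis by (simp add: sup_norm_def)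
qed

text \<open>One bound serves twice: it tends to 0 at infinity, and for \<open>x \<ge> 0\<close> it
  never exceeds \<open>fact d * exp 4\<close>.\<close>

lemma polynomial_gaussian_weight_le:
  fixes x :: real assumes "0 \<le> x"
  shows "(1 + x) ^ d * exp (x\<^sup>2 / 4 - x\<^sup>2) \<le> fact d * exp (4 - x)"
proof -
  \<comment> \<open>Twelve times the difference of the two sides is
    \<open>(3 * x - 4)\<^sup>2 + 20\<close>.\<close>
  have "1 + x + (x\<^sup>2 / 4 - x\<^sup>2) \<le> 4 - x"
    using zero_le_power2[of "3 * x - 4"] by (simp add: power2_eq_square algebra_simps)
  then have "exp (1 + x) * exp (x\<^sup>2 / 4 - x\<^sup>2) \<le> exp (4 - x)"
    by (simp flip: exp_add)
  then have "fact d * (exp (1 + x) * exp (x\<^sup>2 / 4 - x\<^sup>2)) \<le> fact d * exp (4 - x)"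
    by (rule mult_left_mono) simp
  moreover have "(1 + x) ^ d * exp (x\<^sup>2 / 4 - x\<^sup>2) \<le> fact d * (exp (1 + x) * exp (x\<^sup>2 / 4 - x\<^sup>2))"
    unfolding mult.assoc[symmetric] using power_le_fact_exp[of "1 + x" d] assms by (intro mult_right_mono) auto
  ultimately show ?thesis by (rule order_trans[rotated])
qed

lemma polynomial_gaussian_weight_tendsto:
  "((\<lambda>u :: 'a::real_normed_vector. (1 + norm u) ^ d * exp ((norm u)\<^sup>2 / 4 - (norm u)\<^sup>2)) \<longlongrightarrow> 0) at_infinity"
proof (rule tendsto_sandwich[OF _ _ tendsto_const])
  have "filterlim (\<lambda>u :: 'a. - 4 + norm u) at_top at_infinity"
    by (rule filterlim_tendsto_add_at_top[OF tendsto_const filterlim_norm_at_top])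
  then have "filterlim (\<lambda>u :: 'a. 4 - norm u) at_bot at_infinity"
    by (simp add: filterlim_uminus_at_bot)
  from filterlim_compose[OF exp_at_bot this]
  show "((\<lambda>u :: 'a. fact d * exp (4 - norm u)) \<longlongrightarrow> 0) at_infinity"
    by (rule tendsto_mult_right_zero)
qed (simp, intro always_eventually allI polynomial_gaussian_weight_le norm_ge_zero)

section \<open>Analyticity of the orbit map\<close>

theorem theorem2:
  fixes G :: "(real^'n^'n) set" and M :: "(real^'n) set" and \<phi> :: "real^'n \<Rightarrow> complex"
  assumes "real_linear_algebraic_group G"
    and "smooth_affine_variety M"
    and "\<And>g m. g \<in> G \<Longrightarrow> m \<in> M \<Longrightarrow> g *v m \<in> M"
    and "\<phi> \<in> gaussian_polynomials M"
  shows "analytic_vector G (C0 M) (sup_norm M) left_regular \<phi>"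
proof -
  have closed: "closed M"
    using assms(2) by (simp add: smooth_affine_variety_def algebraic_set_closed)
  have inv: "invertible g" "matrix_inv g \<in> G" if "g \<in> G" for g
    using assms(1) that unfolding real_linear_algebraic_group_def by auto
  have mul: "g ** h \<in> G" if "g \<in> G" "h \<in> G" for g h
    using assms(1) that unfolding real_linear_algebraic_group_def by auto
  \<comment> \<open>The implication from left to right makes the translates of \<open>\<phi>\<close>
    vanish off \<open>M\<close>.\<close>
  have stable: "matrix_inv g *v m \<in> M \<longleftrightarrow> m \<in> M" if "g \<in> G" for g m
  proof
    assume "matrix_inv g *v m \<in> M"
    then have "g *v (matrix_inv g *v m) \<in> M" by (rule assms(3)[OF that])
    then show "m \<in> M" using inv[OF that] by (simp add: matrix_vector_mul_assoc matrix_inv_inverse)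
  qed (use assms(3) inv that in auto)
  obtain p where p: "polynomial_function p"
    and "\<phi> = (\<lambda>m. (if m \<in> M then p m else 0) * of_real (exp (- (\<Sum>i\<in>UNIV. (m $ i)\<^sup>2))))"
    using assms(4) unfolding gaussian_polynomials_def coordinate_ring_def by blast
  then have \<phi>: "\<phi> = (\<lambda>m. if m \<in> M then p m * of_real (exp (- (\<Sum>i\<in>UNIV. (m $ i)\<^sup>2))) else 0)"
    by auto
  have left_regular: "left_regular g \<phi> = (\<lambda>m. if m \<in> M
      then p (matrix_inv g *v m) * of_real (exp (- (\<Sum>i\<in>UNIV. ((matrix_inv g *v m) $ i)\<^sup>2))) else 0)"
    if "g \<in> G" for g
    by (simp add: left_regular_def \<phi> stable[OF that])
  \<comment> \<open>The Gaussian factor dictates \<open>r\<close>; the polynomial factor then has a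
    majorant at that radius.\<close>
  have series: "\<exists>r>0. \<exists>d C. majorized E r (\<lambda>u. (1 + norm u) ^ d * exp ((norm u)\<^sup>2 / 4 - (norm u)\<^sup>2)) C
      (\<lambda>t u. let v = matrix_exp (- (\<Sum>b\<in>E. t b *\<^sub>R b)) *v u in
         p v * of_real (exp (- (\<Sum>i\<in>UNIV. (v $ i)\<^sup>2))))"
    if E: "finite E" for E :: "(real^'n^'n) set"
  proof -
    obtain r where r: "r > 0" and gauss: "majorized E r (\<lambda>u. exp (norm u ^ 2 / 4 - norm u ^ 2)) 2
     (\<lambda>t u. of_real (exp (- (\<Sum>i\<in>UNIV. ((matrix_exp (- (\<Sum>b\<in>E. t b *\<^sub>R b)) *v u) $ i)\<^sup>2))))"
      using gaussian_orbit_majorized[OF E] by blast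
    obtain d C where poly: "majorized E r (\<lambda>u. (1 + norm u) ^ d) C
     (\<lambda>t u. p (matrix_exp (- (\<Sum>b\<in>E. t b *\<^sub>R b)) *v u))"
      using complex_polynomial_orbit_majorized[OF E _ p] r by (meson less_imp_le)
    show ?thesis
      using majorized_mult[OF poly gauss] r by (auto simp: Let_def)
  qed
  have C0: "(\<lambda>m. if m \<in> M then p (h *v m) * of_real (exp (- (\<Sum>i\<in>UNIV. ((h *v m) $ i)\<^sup>2))) else 0) \<in> C0 M"
    if "k ** h = mat 1" for k h
  proof -
    \<comment> \<open>Without coordinates the exponent is an empty sum, so the majorant becomes a
      bound on the Gaussian polynomial itself.\<close>
    obtain r d C where r: "r > 0" and maj: "majorized {} r (\<lambda>u. (1 + norm u) ^ d * exp ((norm u)\<^sup>2 / 4 - (norm u)\<^sup>2)) C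
      (\<lambda>t u. let v = matrix_exp (- (\<Sum>b\<in>{}. t b *\<^sub>R b)) *v u in
         p v * of_real (exp (- (\<Sum>i\<in>UNIV. (v $ i)\<^sup>2))))"
      using series[OF finite.emptyI] by blast
    have "matrix_exp 0 = (mat 1 :: real^'n^'n)"
    proof -
      have "matrix_exp (0 :: real^'n^'n) $ i $ j = (mat 1 :: real^'n^'n) $ i $ j" for i j
      proof (rule sums_unique2[OF matrix_exp_entry(2)])
        have "matrix_power (0 :: real^'n^'n) k $ i $ j / fact k = (if k = 0 then (mat 1 :: real^'n^'n) $ i $ j else 0)" for k
          by (cases k) (simp_all add: matrix_power_Suc)
        then show "(\<lambda>k. matrix_power (0 :: real^'n^'n) k $ i $ j / fact k) sums (mat 1 :: real^'n^'n) $ i $ j"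
          using sums_single[of 0 "\<lambda>_. (mat 1 :: real^'n^'n) $ i $ j"] by simp
      qed
      then show ?thesis by (simp add: vec_eq_iff)
    qed
    with majorized_norm_le[OF maj] have le: "cmod (p u * of_real (exp (- (\<Sum>i\<in>UNIV. (u $ i)\<^sup>2))))
       \<le> C * ((1 + norm u) ^ d * exp ((norm u)\<^sup>2 / 4 - (norm u)\<^sup>2))" for u
      by simp
    have cont: "continuous_on UNIV (\<lambda>u. p u * of_real (exp (- (\<Sum>i\<in>UNIV. (u $ i)\<^sup>2))))"
      by (intro continuous_intros continuous_on_polymonial_function p)
    show ?thesis
      by (rule C0_transformI[OF closed cont le polynomial_gaussian_weight_tendsto that])
  qed
  have in_C0: "left_regular g \<phi> \<in> C0 M" if "g \<in> G" for g
    unfolding left_regular[OF that] by (rule C0[OF matrix_inv_inverse(1)[OF inv(1)[OF that]]])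
  show ?thesis
    unfolding analytic_vector_def analytic_map_def
  proof (intro conjI ballI allI impI in_C0)
    show "\<phi> \<in> C0 M" using C0[OF matrix_mul_lid[of "mat 1"]] unfolding \<phi> matrix_vector_mul_lid .
  next
    fix g and E :: "(real^'n^'n) set"
    assume g: "g \<in> G" and "independent E \<and> span E = lie_algebra G"
    then have E: "finite E" "span E = lie_algebra G" by (auto simp: independent_imp_finite)
    \<comment> \<open>The radius depends on \<open>E\<close> but not on \<open>g\<close>, which
      enters only through \<open>u = matrix_inv g *v m\<close>.\<close>
    obtain r d C where r: "r > 0" and maj: "majorized E r (\<lambda>u. (1 + norm u) ^ d * exp ((norm u)\<^sup>2 / 4 - (norm u)\<^sup>2)) C
      (\<lambda>t u. let v = matrix_exp (- (\<Sum>b\<in>E. t b *\<^sub>R b)) *v u in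
         p v * of_real (exp (- (\<Sum>i\<in>UNIV. (v $ i)\<^sup>2))))"
      using series[OF E(1)] by blast
    let ?W = "\<lambda>u::real^'n. (1 + norm u) ^ d * exp ((norm u)\<^sup>2 / 4 - (norm u)\<^sup>2)"
    let ?F = "\<lambda>t u. let v = matrix_exp (- (\<Sum>b\<in>E. t b *\<^sub>R b)) *v u in
         p v * of_real (exp (- (\<Sum>i\<in>UNIV. (v $ i)\<^sup>2)))"
    have W: "continuous_on UNIV ?W" by (auto intro!: continuous_intros)
    obtain c a where c: "\<And>\<alpha>. continuous_on UNIV (c \<alpha>)"
      and c_le: "\<And>\<alpha> u. cmod (c \<alpha> u) * r ^ (\<Sum>b\<in>E. \<alpha> b) \<le> a \<alpha> * ?W u"
      and a: "a summable_on multi_indices E"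
      and c_sum: "\<And>t u. (\<forall>b\<in>E. \<bar>t b\<bar> \<le> r) \<Longrightarrow>
        ((\<lambda>\<alpha>. of_real (\<Prod>b\<in>E. t b ^ \<alpha> b) * c \<alpha> u) has_sum ?F t u) (multi_indices E)"
      by (rule majorized_power_series[OF maj W r]) (rule that)
    define h where "h = matrix_inv g"
    have gh: "g ** h = mat 1" unfolding h_def by (rule matrix_inv_inverse[OF inv(1)[OF g]])
    define c' where "c' \<alpha> m = (if m \<in> M then c \<alpha> (h *v m) else 0)" for \<alpha> m
    define B :: real where "B = fact d * exp 4"
    have WB: "?W u \<le> B" for u
      unfolding B_def by (rule order_trans[OF polynomial_gaussian_weight_le]) auto
    \<comment> \<open>At \<open>u = 0\<close> the weight is 1, so the coefficient bound there
      reveals the sign of \<open>a \<alpha>\<close>.\<close>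
    have a0: "0 \<le> a \<alpha>" for \<alpha>
      using order_trans[OF _ c_le[of \<alpha> 0]] r by simp
    have "c' \<alpha> \<in> C0 M" for \<alpha>
      unfolding c'_def
    proof (rule C0_transformI[OF closed c _ polynomial_gaussian_weight_tendsto gh])
      show "cmod (c \<alpha> u) \<le> (a \<alpha> / r ^ (\<Sum>b\<in>E. \<alpha> b)) * ?W u" for u
        using c_le[of \<alpha> u] r by (simp add: field_simps)
    qed
    moreover have "((\<lambda>A. sup_norm M (\<lambda>x. left_regular (g ** matrix_exp (\<Sum>b\<in>E. t b *\<^sub>R b)) \<phi> x -
          (\<Sum>\<alpha>\<in>A. of_real (\<Prod>b\<in>E. t b ^ \<alpha> b) * c' \<alpha> x))) \<longlongrightarrow> 0) (finite_subsets_at_top (multi_indices E))"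
      if "\<forall>b\<in>E. \<bar>t b\<bar> < r" for t
    proof -
      have t: "\<forall>b\<in>E. \<bar>t b\<bar> \<le> r" using that by auto
      let ?X = "\<Sum>b\<in>E. t b *\<^sub>R b"
      have "?X \<in> lie_algebra G"
        unfolding E(2)[symmetric] by (intro span_sum span_scale span_base)
      then have "matrix_exp (1 *\<^sub>R ?X) \<in> G" unfolding lie_algebra_def by blast
      then have gX: "g ** matrix_exp ?X \<in> G" using mul g by simp
      have lr: "left_regular (g ** matrix_exp ?X) \<phi> m = (if m \<in> M then ?F t (h *v m) else 0)" for m
        unfolding left_regular[OF gX] matrix_inv_mult_exp[OF inv(1)[OF g]]
        by (simp add: h_def Let_def matrix_vector_mul_assoc)
      \<comment> \<open>Once \<open>A\<close> is removed, the remaining terms are dominated by the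
        tail of \<open>a\<close> times the weight. Replacing the weight by its upper bound
        \<open>B\<close> makes this uniform in \<open>m\<close>, hence an estimate of the
        norm.\<close>
      have bound: "\<bar>sup_norm M (\<lambda>x. left_regular (g ** matrix_exp ?X) \<phi> x -
          (\<Sum>\<alpha>\<in>A. of_real (\<Prod>b\<in>E. t b ^ \<alpha> b) * c' \<alpha> x))\<bar> \<le> (infsum a (multi_indices E) - sum a A) * B"
        if A: "finite A" "A \<subseteq> multi_indices E" for A
      proof -
        have rest: "(a has_sum (infsum a (multi_indices E) - sum a A)) (multi_indices E - A)"
          using A a by (intro has_sum_Diff) auto
        then have rest0: "0 \<le> infsum a (multi_indices E) - sum a A"
          by (rule has_sum_nonneg) (rule a0)
        show ?thesis
        proof (rule sup_norm_le)
          show "0 \<le> (infsum a (multi_indices E) - sum a A) * B"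
            using rest0 by (simp add: B_def)
          fix m assume "m \<in> M"
          let ?u = "h *v m"
          have "((\<lambda>\<alpha>. of_real (\<Prod>b\<in>E. t b ^ \<alpha> b) * c \<alpha> ?u) has_sum
             (?F t ?u - (\<Sum>\<alpha>\<in>A. of_real (\<Prod>b\<in>E. t b ^ \<alpha> b) * c \<alpha> ?u))) (multi_indices E - A)"
            using A by (intro has_sum_Diff c_sum t) auto
          then have "cmod (?F t ?u - (\<Sum>\<alpha>\<in>A. of_real (\<Prod>b\<in>E. t b ^ \<alpha> b) * c \<alpha> ?u))
             \<le> (infsum a (multi_indices E) - sum a A) * ?W ?u"
            by (rule norm_infsum_le[OF _ has_sum_cmult_left[OF rest]]) (rule monomial_term_le[OF t c_le])
          also have "\<dots> \<le> (infsum a (multi_indices E) - sum a A) * B"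
            by (rule mult_left_mono[OF WB rest0])
          finally show "cmod (left_regular (g ** matrix_exp ?X) \<phi> m -
              (\<Sum>\<alpha>\<in>A. of_real (\<Prod>b\<in>E. t b ^ \<alpha> b) * c' \<alpha> m)) \<le> (infsum a (multi_indices E) - sum a A) * B"
            using \<open>m \<in> M\<close> by (simp only: lr c'_def if_True)
        qed
      qed
      have "((\<lambda>A. (infsum a (multi_indices E) - sum a A) * B) \<longlongrightarrow> (infsum a (multi_indices E) - infsum a (multi_indices E)) * B)
          (finite_subsets_at_top (multi_indices E))"
        by (intro tendsto_intros infsum_tendsto a)
      then have lim: "((\<lambda>A. (infsum a (multi_indices E) - sum a A) * B) \<longlongrightarrow> 0) (finite_subsets_at_top (multi_indices E))"
        by simp
      show ?thesis
        by (rule Lim_null_comparison[OF _ lim])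
          (use bound in \<open>auto intro!: eventually_finite_subsets_at_top_weakI simp del: of_real_prod of_real_power\<close>)
    qed
    ultimately show "\<exists>\<epsilon>>0. \<exists>c. (\<forall>\<alpha>\<in>multi_indices E. c \<alpha> \<in> C0 M) \<and>
        (\<forall>t. (\<forall>b\<in>E. \<bar>t b\<bar> < \<epsilon>) \<longrightarrow>
          ((\<lambda>A. sup_norm M (\<lambda>x. left_regular (g ** matrix_exp (\<Sum>b\<in>E. t b *\<^sub>R b)) \<phi> x -
             (\<Sum>\<alpha>\<in>A. of_real (\<Prod>b\<in>E. t b ^ \<alpha> b) * c \<alpha> x)))
           \<longlongrightarrow> 0) (finite_subsets_at_top (multi_indices E)))"
      using r by (intro exI[of _ r] conjI exI[of _ c'] ballI allI impI)
  qed
qed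

end
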